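(* If $f\in W^{1,1}_{\rm loc}(\mathbb{R}^n)$, then $$Sf(x)=\Big(\int_0^\infty |\psi_t*\nabla f(x)|^2\frac{dt}{t}\Big)^{1/2}=\frac{1}{n\omega_n}\Big(\int_0^\infty\Big|\int_{|y|\leq t}\Big(\frac{y}{|y|^n}-\frac{y}{t^n}\Big)\cdot\nabla f(x-y)\, dy\Big|^2\frac{dt}{t^3}\Big)^{1/2}$$ for almost all $x\in\mathbb{R}^n$.
   Context: Here $n\ge1$ and $\omega_n$ is the volume of the unit ball in $\mathbb{R}^n$. $f_{B(x,t)}$ is the average of $f$ over the ball $B(x,t)$ of center $x$ and radius $t$, and $$Sf(x)=\Big(\int_0^\infty \big|f(x)-f_{B(x,t)}\big|^2\,\frac{dt}{t^3}\Big)^{1/2}\in[0,\infty].$$ The function $\psi:\mathbb{R}^n\to\mathbb{R}^n$ is $\psi(x)=\frac{1}{n\omega_n}\Big(\frac{x}{|x|^n}-x\Big)\chi_{B(0,1)}(x)$, and $\psi_t(x)=t^{-n}\psi(x/t)$ for $t>0$. The convolution is taken with the scalar product: $\psi_t*\nabla f(x)=\int_{\mathbb{R}^n}\psi_t(y)\cdot\nabla f(x-y)\,dy$. $W^{1,1}_{\rm loc}(\mathbb{R}^n)$ is the space of locally integrable functions with locally integrable first order weak derivatives. *)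

theory Defs
  imports "HOL-Analysis.Analysis"
begin

text \<open>The space $\mathbb{R}^n$, $n \ge 1$, is an arbitrary type of class \<^class>\<open>euclidean_space\<close>,
  with $n$ its dimension, and functions are real-valued.\<close>

definition locally_integrable :: "('a::euclidean_space \<Rightarrow> real) \<Rightarrow> bool" where
  "locally_integrable f \<longleftrightarrow> (\<forall>K. compact K \<longrightarrow> set_integrable lebesgue K f)"

primrec C_k :: "nat \<Rightarrow> ('a::euclidean_space \<Rightarrow> real) \<Rightarrow> bool" where
  "C_k 0 \<phi> \<longleftrightarrow> continuous_on UNIV \<phi>"
| "C_k (Suc k) \<phi> \<longleftrightarrow> (\<forall>x. \<phi> differentiable (at x)) \<and>
     (\<forall>i\<in>Basis. C_k k (\<lambda>x. frechet_derivative \<phi> (at x) i))"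

definition test_function :: "('a::euclidean_space \<Rightarrow> real) \<Rightarrow> bool" where
  "test_function \<phi> \<longleftrightarrow> (\<forall>k. C_k k \<phi>) \<and> compact (closure {x. \<phi> x \<noteq> 0})"

definition weak_derivative ::
    "'a::euclidean_space \<Rightarrow> ('a \<Rightarrow> real) \<Rightarrow> ('a \<Rightarrow> real) \<Rightarrow> bool" where
  "weak_derivative i f g \<longleftrightarrow> locally_integrable f \<and> locally_integrable g \<and>
     (\<forall>\<phi>. test_function \<phi> \<longrightarrow>
        (\<integral>x. f x * frechet_derivative \<phi> (at x) i \<partial>lebesgue) = - (\<integral>x. g x * \<phi> x \<partial>lebesgue))"

text \<open>A weak gradient is determined only almost everywhere; this predicate says that \<open>g\<close>
  is one of its representatives.\<close>

definition weak_gradient :: "('a::euclidean_space \<Rightarrow> real) \<Rightarrow> ('a \<Rightarrow> 'a) \<Rightarrow> bool" where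
  "weak_gradient f g \<longleftrightarrow> (\<forall>i\<in>Basis. weak_derivative i f (\<lambda>x. g x \<bullet> i))"

definition W11_loc :: "('a::euclidean_space \<Rightarrow> real) set" where
  "W11_loc = {f. locally_integrable f \<and> (\<forall>i\<in>Basis. \<exists>g. weak_derivative i f g)}"

definition esqrt :: "ennreal \<Rightarrow> ennreal" where
  "esqrt a = (if a = \<infinity> then \<infinity> else ennreal (sqrt (enn2real a)))"

definition ball_average :: "('a::euclidean_space \<Rightarrow> real) \<Rightarrow> 'a \<Rightarrow> real \<Rightarrow> real" where
  "ball_average f x t = (\<integral>y\<in>ball x t. f y \<partial>lebesgue) / measure lebesgue (ball x t)"

definition square_function :: "('a::euclidean_space \<Rightarrow> real) \<Rightarrow> 'a \<Rightarrow> ennreal" where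
  "square_function f x =
     esqrt (\<integral>\<^sup>+t\<in>{0<..}. ennreal (\<bar>f x - ball_average f x t\<bar>\<^sup>2 / t ^ 3) \<partial>lborel)"

definition psi :: "'a::euclidean_space \<Rightarrow> 'a" where
  "psi x = (indicator (ball 0 1) x / (real DIM('a) * unit_ball_vol (real DIM('a)))) *\<^sub>R
     (x /\<^sub>R norm x ^ DIM('a) - x)"

definition psi_scaled :: "real \<Rightarrow> 'a::euclidean_space \<Rightarrow> 'a" where
  "psi_scaled t x = psi (x /\<^sub>R t) /\<^sub>R t ^ DIM('a)"

definition convolution_inner ::
    "('a::euclidean_space \<Rightarrow> 'a) \<Rightarrow> ('a \<Rightarrow> 'a) \<Rightarrow> 'a \<Rightarrow> real" where
  "convolution_inner u v x = (\<integral>y. u y \<bullet> v (x - y) \<partial>lebesgue)"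

end

theory Submission
  imports Defs
begin

text \<open>For a test function \<open>\<phi>\<close>, writing \<open>\<phi> (z + t u) - \<phi> z\<close> as the integral of the radial derivative over
  \<open>0 < r \<le> t\<close>, averaging over \<open>u\<close> in the unit ball and substituting \<open>y = r u\<close> turns the difference between
  the ball average and the value into the integral of \<open>\<nabla>\<phi> (z + y) \<bullet> y\<close> against the weight obtained by integrating
  \<open>n r\<^bsup>-n-1\<^esup>\<close> over \<open>norm y < r \<le> t\<close>, that is \<open>norm y\<^bsup>-n\<^esup> - t\<^bsup>-n\<^esup>\<close>. No polar coordinates are needed.
  By duality and Fubini the same identity holds weakly for \<open>f\<close>, hence almost everywhere for each
  fixed \<open>t\<close>; outside a null set it holds for all rational \<open>t\<close>, and both sides are left-continuous in \<open>t\<close>.\<close>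

section \<open>Smooth bumps and the fundamental lemma\<close>

text \<open>The square functions are compared through their integrands: outside one null set of x,
  for every t > 0, the value minus the ball average equals t times the convolution with
  \<open>psi_scaled t\<close>, and also 1/(n \<omega>_n) times the integral over the closed ball.
  The integrals over t then agree in \<open>ennreal\<close>, so their finiteness never enters.

  The weight norm y^(-n) is not integrable at the origin. It only becomes so with one more factor
  norm y, which the vector y provides in its product with the gradient; this is why the kernel
  always occurs together with a quantity of size O(norm y).

  On test functions the identity yields average minus value and evaluates at z + y. Duality replaces
  z + y by x - y, and the minus sign in the definition of the weak derivative reverses the
  difference. This accounts for both the order of the difference and the argument x - y in the final
  formula.\<close>

lemma C_k_SucI:
  assumes "\<And>x. (\<phi> has_derivative D x) (at x)" and "\<And>i. i \<in> Basis \<Longrightarrow> C_k k (\<lambda>x. D x i)"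
  shows "C_k (Suc k) \<phi>"
proof -
  have "frechet_derivative \<phi> (at x) = D x" for x
    using frechet_derivative_at[OF assms(1)] by simp
  then show ?thesis
    using assms by (auto simp: differentiable_def)
qed

lemma C_k_has_derivative:
  "C_k (Suc k) \<phi> \<Longrightarrow> (\<phi> has_derivative frechet_derivative \<phi> (at x)) (at x)"
  using frechet_derivative_works by auto

text \<open>The Leibniz rule leaves one factor undifferentiated, so the induction in
  \<open>C_k_mult\<close> needs that factor one degree lower.\<close>

lemma C_k_SucD: "C_k (Suc k) \<phi> \<Longrightarrow> C_k k \<phi>"
proof (induction k arbitrary: \<phi>)
  case 0
  then show ?case
    by (auto simp: continuous_on_eq_continuous_at differentiable_imp_continuous_within)
next
  case (Suc k)
  then show ?case
    by (metis C_k.simps(2))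
qed

lemma C_k_add: "C_k k \<phi> \<Longrightarrow> C_k k \<psi> \<Longrightarrow> C_k k (\<lambda>x. \<phi> x + \<psi> x)"
proof (induction k arbitrary: \<phi> \<psi>)
  case 0
  then show ?case by (auto intro!: continuous_intros)
next
  case (Suc k)
  show ?case
  proof (rule C_k_SucI)
    show "((\<lambda>x. \<phi> x + \<psi> x) has_derivative
        (\<lambda>h. frechet_derivative \<phi> (at x) h + frechet_derivative \<psi> (at x) h)) (at x)" for x
      using Suc.prems by (intro has_derivative_add C_k_has_derivative)
  qed (use Suc in auto)
qed

lemma C_k_mult: "C_k k \<phi> \<Longrightarrow> C_k k \<psi> \<Longrightarrow> C_k k (\<lambda>x. \<phi> x * \<psi> x)"
proof (induction k arbitrary: \<phi> \<psi>)
  case 0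
  then show ?case by (auto intro!: continuous_intros)
next
  case (Suc k)
  show ?case
  proof (rule C_k_SucI)
    show "((\<lambda>x. \<phi> x * \<psi> x) has_derivative
        (\<lambda>h. \<phi> x * frechet_derivative \<psi> (at x) h + frechet_derivative \<phi> (at x) h * \<psi> x)) (at x)" for x
      using Suc.prems by (intro has_derivative_mult C_k_has_derivative)
    show "C_k k (\<lambda>x. \<phi> x * frechet_derivative \<psi> (at x) i + frechet_derivative \<phi> (at x) i * \<psi> x)"
      if "i \<in> Basis" for i
      using Suc.prems that C_k_SucD by (intro C_k_add Suc.IH) auto
  qed
qed

lemma C_k_const: "C_k k (\<lambda>x. c)"
proof (induction k arbitrary: c)
  case (Suc k)
  show ?case
    by (rule C_k_SucI[OF has_derivative_const Suc])
qed auto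

lemma C_k_prod: "finite A \<Longrightarrow> (\<And>i. i \<in> A \<Longrightarrow> C_k k (\<phi> i)) \<Longrightarrow> C_k k (\<lambda>x. \<Prod>i\<in>A. \<phi> i x)"
  by (induction A rule: finite_induct) (auto intro: C_k_const C_k_mult)

lemma frechet_derivative_translation:
  assumes "\<phi> differentiable (at (x + c))"
  shows "((\<lambda>x. \<phi> (x + c)) has_derivative frechet_derivative \<phi> (at (x + c))) (at x)"
proof -
  have "((\<lambda>x. x + c) has_derivative (\<lambda>h. h)) (at x)"
    by (auto intro!: derivative_eq_intros)
  from diff_chain_at[OF this, of \<phi>] assms show ?thesis
    by (simp add: o_def frechet_derivative_works)
qed

lemma C_k_translation: "C_k k \<phi> \<Longrightarrow> C_k k (\<lambda>x. \<phi> (x + c))"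
proof (induction k arbitrary: \<phi>)
  case 0
  then show ?case
    by (auto intro!: continuous_on_compose2[of UNIV \<phi>] continuous_intros)
next
  case (Suc k)
  show ?case
    by (rule C_k_SucI[OF frechet_derivative_translation]) (use Suc in auto)
qed

text \<open>The index \<open>j\<close> makes the family stable under differentiation up to linear
  combinations: each derivative of exp(-1/x) only adds powers of 1/x. Smoothness is then an
  induction on \<open>k\<close> for all \<open>j\<close> at once.\<close>

definition flat_exp :: "nat \<Rightarrow> real \<Rightarrow> real" where
  "flat_exp j x = (if x > 0 then exp (- 1 / x) / x ^ j else 0)"

lemma flat_exp_has_real_derivative:
  "(flat_exp j has_real_derivative flat_exp (j + 2) x - real j * flat_exp (Suc j) x) (at x)"
proof -
  consider "x > 0" | "x < 0" | "x = 0" by linarith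
  then show ?thesis
  proof cases
    case 1
    have "((\<lambda>x. exp (- 1 / x) / x ^ j) has_real_derivative
        flat_exp (j + 2) x - real j * flat_exp (Suc j) x) (at x)"
    proof -
      let ?D = "(exp (- 1 / x) * (1 / x\<^sup>2) * x ^ j - exp (- 1 / x) * (real j * x ^ (j - Suc 0))) / (x ^ j * x ^ j)"
      have D: "((\<lambda>x. exp (- 1 / x) / x ^ j) has_real_derivative ?D) (at x)"
        using 1 by (auto intro!: derivative_eq_intros simp: power2_eq_square)
      \<comment> \<open>For \<open>j = 0\<close> the truncated exponent is harmless because the
        factor \<open>real j\<close> vanishes.\<close>
      have "real j * x ^ (j - Suc 0) = real j * x ^ j / x"
        using 1 by (cases j) auto
      then have "?D = (exp (- 1 / x) * (1 / x\<^sup>2) * x ^ j - exp (- 1 / x) * (real j * x ^ j / x)) / (x ^ j * x ^ j)"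
        by simp
      also have "\<dots> = flat_exp (j + 2) x - real j * flat_exp (Suc j) x"
        using 1 by (simp add: flat_exp_def field_simps power_add power2_eq_square)
      finally show ?thesis
        using D by simp
    qed
    then show ?thesis
      by (rule has_field_derivative_transform_within_open[where S = "{0<..}"])
        (use 1 in \<open>auto simp: flat_exp_def\<close>)
  next
    case 2
    have "((\<lambda>x. 0) has_real_derivative flat_exp (j + 2) x - real j * flat_exp (Suc j) x) (at x)"
      using 2 by (auto intro!: derivative_eq_intros simp: flat_exp_def)
    then show ?thesis
      by (rule has_field_derivative_transform_within_open[where S = "{..<0}"])
        (use 2 in \<open>auto simp: flat_exp_def\<close>)
  next
    case 3
    \<comment> \<open>With s = 1/h the right difference quotient at the origin is s^(j+1) / exp s,
      which tends to 0; the left one is identically 0.\<close>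
    have "((\<lambda>h. inverse h ^ Suc j / exp (inverse h)) \<longlongrightarrow> (0::real)) (at_right 0)"
      by (rule filterlim_compose[OF tendsto_power_div_exp_0 filterlim_inverse_at_top_right])
    moreover have "eventually (\<lambda>h. inverse h ^ Suc j / exp (inverse h) =
        (flat_exp j (0 + h) - flat_exp j 0) / h) (at_right 0)"
      using eventually_at_right_less[of 0]
      by eventually_elim (simp add: flat_exp_def exp_minus field_simps)
    ultimately have "((\<lambda>h. (flat_exp j (0 + h) - flat_exp j 0) / h) \<longlongrightarrow> 0) (at_right 0)"
      by (rule Lim_transform_eventually)
    moreover have "((\<lambda>h. (flat_exp j (0 + h) - flat_exp j 0) / h) \<longlongrightarrow> 0) (at_left 0)"
      by (rule tendsto_eventually) (auto simp: eventually_at_filter flat_exp_def)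
    ultimately have "((\<lambda>h. (flat_exp j (0 + h) - flat_exp j 0) / h) \<longlongrightarrow> 0) (at 0)"
      by (simp add: filterlim_split_at)
    then show ?thesis
      using 3 by (simp add: DERIV_def) (simp add: flat_exp_def)
  qed
qed

text \<open>Composition with an affine map is all that bumps on boxes require. The inner derivative
  in a fixed direction is the constant \<open>v \<bullet> i\<close>, so no chain rule for
  \<open>C_k\<close> is involved.\<close>

lemma C_k_flat_exp_affine: "C_k k (\<lambda>x. flat_exp j (v \<bullet> x + d))"
proof (induction k arbitrary: j)
  case 0
  have "isCont (flat_exp j) x" for x
    using flat_exp_has_real_derivative by (rule DERIV_isCont)
  then have "continuous_on UNIV (flat_exp j)"
    by (simp add: continuous_at_imp_continuous_on)
  then show ?case
    by (auto intro!: continuous_on_compose2[of UNIV "flat_exp j"] continuous_intros)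
next
  case (Suc k)
  show ?case
  proof (rule C_k_SucI)
    show "((\<lambda>x. flat_exp j (v \<bullet> x + d)) has_derivative
      (\<lambda>h. (flat_exp (j + 2) (v \<bullet> x + d) + (- real j) * flat_exp (Suc j) (v \<bullet> x + d)) * (v \<bullet> h))) (at x)"
      for x
    proof -
      have "((\<lambda>x. v \<bullet> x + d) has_derivative (\<lambda>h. v \<bullet> h)) (at x)"
        by (auto intro!: derivative_eq_intros)
      from diff_chain_at[OF this flat_exp_has_real_derivative[THEN has_field_derivative_imp_has_derivative]]
      show ?thesis by (simp add: o_def algebra_simps)
    qed
    show "C_k k (\<lambda>x. (flat_exp (j + 2) (v \<bullet> x + d) + (- real j) * flat_exp (Suc j) (v \<bullet> x + d)) * (v \<bullet> i))" for i
      by (intro C_k_mult C_k_add C_k_const Suc)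
  qed
qed

text \<open>The factor \<open>Suc m\<close> steepens the bump: exp(-1/((m+1) s)) tends to 1 for
  every s > 0, while the support stays in the same box. This gives smooth functions between 0 and 1
  converging to the indicator of an open box without any mollification.\<close>

definition box_bump :: "'a::euclidean_space \<Rightarrow> 'a \<Rightarrow> nat \<Rightarrow> 'a \<Rightarrow> real" where
  "box_bump a b m x = (\<Prod>i\<in>Basis. flat_exp 0 (real (Suc m) * ((x - a) \<bullet> i)) *
     flat_exp 0 (real (Suc m) * ((b - x) \<bullet> i)))"

lemma flat_exp_0_bounds: "0 \<le> flat_exp 0 x" "flat_exp 0 x \<le> 1"
  by (auto simp: flat_exp_def)

lemma box_bump_eq_0:
  assumes "x \<notin> box a b"
  shows "box_bump a b m x = 0"
proof -
  obtain i where "i \<in> Basis" "x \<bullet> i \<le> a \<bullet> i \<or> b \<bullet> i \<le> x \<bullet> i"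
    using assms by (auto simp: mem_box not_less)
  then show ?thesis
    unfolding box_bump_def
    by (intro prod_zero bexI[of _ i])
      (auto simp: flat_exp_def inner_diff_left zero_less_mult_iff simp del: of_nat_Suc)
qed

lemma box_bump_bounds: "0 \<le> box_bump a b m x" "box_bump a b m x \<le> 1"
  unfolding box_bump_def
  by (auto intro!: prod_nonneg prod_le_1 mult_le_one mult_nonneg_nonneg simp: flat_exp_0_bounds)

lemma box_bump_tendsto: "(\<lambda>m. box_bump a b m x) \<longlonglongrightarrow> indicator (box a b) x"
proof (cases "x \<in> box a b")
  case True
  have *: "(\<lambda>m. flat_exp 0 (real (Suc m) * y)) \<longlonglongrightarrow> 1" if "y > 0" for y
  proof -
    have "(\<lambda>m. exp (- (inverse y) * inverse (real (Suc m)))) \<longlonglongrightarrow> exp (- (inverse y) * 0)"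
      by (intro tendsto_intros LIMSEQ_inverse_real_of_nat)
    moreover have "flat_exp 0 (real (Suc m) * y) = exp (- (inverse y) * inverse (real (Suc m)))" for m
      using that by (simp add: flat_exp_def divide_simps del: of_nat_Suc)
    ultimately show ?thesis by simp
  qed
  have "(\<lambda>m. box_bump a b m x) \<longlonglongrightarrow> (\<Prod>i\<in>(Basis::'a set). 1 * 1)"
    unfolding box_bump_def
    by (intro tendsto_intros *) (use True in \<open>auto simp: mem_box inner_diff_left\<close>)
  then show ?thesis using True by simp
qed (simp add: box_bump_eq_0)

lemma test_function_box_bump: "test_function (box_bump a b m)"
  unfolding test_function_def
proof
  have "C_k k (\<lambda>x. flat_exp 0 (real (Suc m) * ((x - a) \<bullet> i)))"
       "C_k k (\<lambda>x. flat_exp 0 (real (Suc m) * ((b - x) \<bullet> i)))" for k i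
    using C_k_flat_exp_affine[of k 0 "real (Suc m) *\<^sub>R i" "- (real (Suc m) * (a \<bullet> i))"]
      C_k_flat_exp_affine[of k 0 "- real (Suc m) *\<^sub>R i" "real (Suc m) * (b \<bullet> i)"]
    by (simp_all add: algebra_simps inner_commute)
  then show "\<forall>k. C_k k (box_bump a b m)"
    unfolding box_bump_def by (intro allI C_k_prod C_k_mult) auto
  have "{x. box_bump a b m x \<noteq> 0} \<subseteq> box a b"
    using box_bump_eq_0 by blast
  then show "compact (closure {x. box_bump a b m x \<noteq> 0})"
    using bounded_subset bounded_box compact_closure by blast
qed

section \<open>Uniqueness of measures on open boxes and the fundamental lemma of the calculus of
  variations\<close>

lemma measure_eqI_box:
  fixes M N :: "'a::euclidean_space measure"
  assumes "sets M = sets borel" "sets N = sets borel"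
    and "\<And>a b. emeasure M (box a b) = emeasure N (box a b)"
    and "\<And>a b. emeasure M (box a b) \<noteq> \<infinity>"
  shows "M = N"
proof (rule measure_eqI_generator_eq)
  let ?E = "range (\<lambda>(a, b). box a b::'a set)"
  show "Int_stable ?E"
    by (auto simp: Int_stable_def box_Int_box)
  show "?E \<subseteq> Pow UNIV" "sets M = sigma_sets UNIV ?E" "sets N = sigma_sets UNIV ?E"
    by (simp_all add: borel_eq_box assms)
  let ?A = "\<lambda>n::nat. box (- (real n *\<^sub>R One)) (real n *\<^sub>R One) :: 'a set"
  show "range ?A \<subseteq> ?E" "(\<Union>i. ?A i) = UNIV"
    unfolding UN_box_eq_UNIV by auto
qed (use assms in auto)

text \<open>Testing against bumps that increase to the indicator of a box shows that the positive and
  the negative part of \<open>g\<close> are densities of the same measure.\<close>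

lemma AE_eq_0_if_test_integrals_eq_0:
  fixes g :: "'a::euclidean_space \<Rightarrow> real"
  assumes g[measurable]: "g \<in> borel_measurable borel"
    and int: "\<And>K. compact K \<Longrightarrow> set_integrable lborel K g"
    and eq_0: "\<And>\<phi>. test_function \<phi> \<Longrightarrow> (\<integral>x. \<phi> x * g x \<partial>lborel) = 0"
  shows "AE x in lborel. g x = 0"
proof -
  have cbox: "integrable lborel (\<lambda>x. indicator (cbox a b) x * g x)" for a b
    using int[OF compact_cbox[of a b]] by (simp add: set_integrable_def)
  have box: "integrable lborel (\<lambda>x. indicator (box a b) x * g x)" for a b
    by (rule Bochner_Integration.integrable_bound[OF cbox[of a b]])
      (use box_subset_cbox[of a b] in \<open>auto simp: indicator_def\<close>)
  have zero: "(\<integral>x. indicator (box a b) x * g x \<partial>lborel) = 0" for a b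
  proof -
    have [measurable]: "box_bump a b m \<in> borel_measurable borel" for m
      using test_function_box_bump[of a b m] C_k.simps(1) borel_measurable_continuous_onI
      unfolding test_function_def by blast
    have "(\<lambda>m. \<integral>x. box_bump a b m x * g x \<partial>lborel) \<longlonglongrightarrow> (\<integral>x. indicator (box a b) x * g x \<partial>lborel)"
    proof (rule integral_dominated_convergence[where w = "\<lambda>x. \<bar>indicator (cbox a b) x * g x\<bar>"])
      show "AE x in lborel. (\<lambda>m. box_bump a b m x * g x) \<longlonglongrightarrow> indicator (box a b) x * g x"
        by (intro AE_I2 tendsto_intros box_bump_tendsto)
      show "AE x in lborel. norm (box_bump a b m x * g x) \<le> \<bar>indicator (cbox a b) x * g x\<bar>" for m
      proof (intro AE_I2)
        fix x
        show "norm (box_bump a b m x * g x) \<le> \<bar>indicator (cbox a b) x * g x\<bar>"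
          using box_bump_eq_0[of x a b m] box_bump_bounds[of a b m x] box_subset_cbox[of a b]
          by (cases "x \<in> box a b") (auto simp: abs_mult indicator_def intro!: mult_left_le_one_le)
      qed
    qed (use cbox in auto)
    then show ?thesis
      using eq_0[OF test_function_box_bump[of a b]] by (simp add: LIMSEQ_const_iff)
  qed
  let ?M = "\<lambda>h. density lborel (\<lambda>x. ennreal (h x))"
  \<comment> \<open>\<open>ennreal\<close> truncates negative values to 0, so the density measures
    the positive part. The local \<open>g\<close> is arbitrary, which allows the use for both
    \<open>g\<close> and \<open>- g\<close>.\<close>
  have pos: "emeasure (?M g) (box a b) = ennreal (\<integral>x. max 0 (indicator (box a b) x * g x) \<partial>lborel)"
    if "integrable lborel (\<lambda>x. indicator (box a b) x * g x)" and [measurable]: "g \<in> borel_measurable borel"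
    for g :: "'a \<Rightarrow> real" and a b
  proof -
    have "emeasure (?M g) (box a b) = (\<integral>\<^sup>+x. ennreal (max 0 (indicator (box a b) x * g x)) \<partial>lborel)"
      by (subst emeasure_density)
        (auto intro!: nn_integral_cong simp: indicator_def max_def ennreal_neg)
    also have "\<dots> = ennreal (\<integral>x. max 0 (indicator (box a b) x * g x) \<partial>lborel)"
      using that by (intro nn_integral_eq_integral) auto
    finally show ?thesis .
  qed
  have eq: "emeasure (?M g) (box a b) = emeasure (?M (\<lambda>x. - g x)) (box a b)" for a b
  proof -
    let ?h = "\<lambda>x. indicator (box a b) x * g x"
    have "(\<integral>x. max 0 (?h x) \<partial>lborel) - (\<integral>x. max 0 (- ?h x) \<partial>lborel)
        = (\<integral>x. max 0 (?h x) - max 0 (- ?h x) \<partial>lborel)"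
      using box[of a b] by (intro Bochner_Integration.integral_diff[symmetric] integrable_max) auto
    also have "\<dots> = (\<integral>x. ?h x \<partial>lborel)"
      by (intro Bochner_Integration.integral_cong) auto
    finally show ?thesis
      using box[of a b] zero[of a b] by (simp add: pos)
  qed
  have "?M g = ?M (\<lambda>x. - g x)"
    using eq box by (intro measure_eqI_box) (auto simp: pos)
  \<comment> \<open>At every point at least one of the two truncated values is 0; if they agree,
    both are, and \<open>g x = 0\<close>.\<close>
  then have "AE x in lborel. ennreal (g x) = ennreal (- g x)"
    by (intro sigma_finite_measure.density_unique[OF sigma_finite_lborel]) auto
  then show ?thesis
  proof eventually_elim
    case (elim x)
    show ?case
      using elim ennreal_neg[of "g x"] ennreal_neg[of "- g x"]
        ennreal_eq_0_iff[of "g x"] ennreal_eq_0_iff[of "- g x"]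
      by (cases "g x \<ge> 0") auto
  qed
qed

section \<open>The radial kernel\<close>

lemma density_lborel_affine:
  assumes "c \<noteq> 0"
  shows "density (distr lborel borel (\<lambda>x. t + c *\<^sub>R x)) (\<lambda>_. ennreal (\<bar>c\<bar> ^ DIM('a))) = (lborel :: 'a::euclidean_space measure)"
  using lborel_affine[OF assms, of t] by (simp add: ennreal_power)

lemma lborel_integrable_affine:
  fixes f :: "'a::euclidean_space \<Rightarrow> real"
  assumes "c \<noteq> 0" and "integrable lborel f"
  shows "integrable lborel (\<lambda>x. f (t + c *\<^sub>R x))"
proof -
  have [measurable]: "f \<in> borel_measurable borel"
    using assms by auto
  have "integrable (density (distr lborel borel (\<lambda>x. t + c *\<^sub>R x)) (\<lambda>_. ennreal (\<bar>c\<bar> ^ DIM('a)))) f"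
    unfolding density_lborel_affine[OF assms(1)] by (rule assms(2))
  then show ?thesis
    using assms(1) by (simp add: integrable_density integrable_distr_eq)
qed

lemma lborel_integral_affine:
  fixes f :: "'a::euclidean_space \<Rightarrow> real"
  assumes "c \<noteq> 0" and [measurable]: "f \<in> borel_measurable borel"
  shows "(\<integral>x. f x \<partial>lborel) = \<bar>c\<bar> ^ DIM('a) * (\<integral>x. f (t + c *\<^sub>R x) \<partial>lborel)"
  by (subst density_lborel_affine[OF assms(1), symmetric, of t], subst integral_density)
    (auto simp: integral_distr)

lemma AE_lborel_affine:
  fixes t :: "'a::euclidean_space"
  assumes "c \<noteq> 0" and "AE x in lborel. P x"
  shows "AE x in lborel. P (t + c *\<^sub>R x)"
proof -
  have "AE x in density (distr lborel borel (\<lambda>x. t + c *\<^sub>R x)) (\<lambda>_. ennreal (\<bar>c\<bar> ^ DIM('a))). P x"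
    unfolding density_lborel_affine[OF assms(1)] by (rule assms(2))
  then have "AE x in distr lborel borel (\<lambda>x. t + c *\<^sub>R x). P x"
    using assms(1) by (simp add: AE_density)
  then show ?thesis
    by (rule AE_distrD[rotated]) simp
qed

text \<open>The scalar factor of the vector kernel y / norm y^n - y / t^n. It is not integrable at
  the origin for t > 0, but \<open>radial_kernel t y * norm y\<close> is. The bracket vanishes for
  \<open>norm y = t\<close>, so the open ball serves for the closed one as well.\<close>

definition radial_kernel :: "real \<Rightarrow> 'a::euclidean_space \<Rightarrow> real" where
  "radial_kernel t y = indicator (ball 0 t) y * (1 / norm y ^ DIM('a) - 1 / t ^ DIM('a))"

lemma borel_measurable_radial_kernel [measurable]: "radial_kernel t \<in> borel_measurable borel"
  unfolding radial_kernel_def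
  by (intro borel_measurable_times borel_measurable_indicator borel_measurable_diff
      borel_measurable_divide borel_measurable_power borel_measurable_const borel_measurable_norm) auto

text \<open>The origin is excluded because \<open>1 / 0 = 0\<close>.\<close>

lemma radial_kernel_layers:
  fixes y :: "'a::euclidean_space"
  assumes "y \<noteq> 0"
  shows "integrable lborel (\<lambda>r. if norm y < r \<and> r \<le> t then real DIM('a) / r ^ Suc DIM('a) else 0)" (is ?A)
    and "(\<integral>r. (if norm y < r \<and> r \<le> t then real DIM('a) / r ^ Suc DIM('a) else 0) \<partial>lborel) = radial_kernel t y" (is ?B)
proof -
  let ?n = "DIM('a)"
  let ?w = "\<lambda>r::real. real ?n / r ^ Suc ?n"
  let ?I = "\<lambda>r. if norm y < r \<and> r \<le> t then ?w r else 0"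
  have "?A \<and> ?B"
  proof (cases "norm y < t")
    case False
    then have "?I = (\<lambda>_. 0)" by auto
    then show ?thesis using False by (simp add: radial_kernel_def)
  next
    case True
    have pos: "norm y > 0" using assms by simp
    have cont: "continuous_on {norm y..t} ?w"
      using pos by (intro continuous_intros) auto
    \<comment> \<open>The strict inequality in \<open>?I\<close> reflects the open ball, whereas the
      fundamental theorem of calculus is applied on a closed interval; they differ in one
      point.\<close>
    have "AE r in lborel. r \<noteq> norm y"
      by (rule AE_lborel_singleton)
    then have ae: "AE r in lborel. indicator {norm y..t} r *\<^sub>R ?w r = ?I r"
      by eventually_elim (auto simp: indicator_def)
    have int: "integrable lborel (\<lambda>r. indicator {norm y..t} r *\<^sub>R ?w r)"
      by (rule borel_integrable_compact[OF compact_Icc cont])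
    have "(\<integral>r. indicator {norm y..t} r *\<^sub>R ?w r \<partial>lborel) = - 1 / t ^ ?n - (- 1 / norm y ^ ?n)"
    proof (rule integral_FTC_atLeastAtMost)
      fix r assume r: "norm y \<le> r" "r \<le> t"
      have "((\<lambda>r. - 1 / r ^ ?n) has_real_derivative (real ?n * r ^ (?n - Suc 0)) / (r ^ ?n * r ^ ?n)) (at r within {norm y..t})"
        using r pos by (auto intro!: derivative_eq_intros)
      moreover have "(real ?n * r ^ (?n - Suc 0)) / (r ^ ?n * r ^ ?n) = ?w r"
      proof -
        have "r ^ ?n = r * r ^ (?n - Suc 0)"
          by (metis DIM_positive Suc_pred power_Suc)
        moreover have "r \<noteq> 0" using r pos by auto
        ultimately show ?thesis by (simp add: field_simps)
      qed
      ultimately show "((\<lambda>r. - 1 / r ^ ?n) has_vector_derivative ?w r) (at r within {norm y..t})"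
        by (simp add: has_real_derivative_iff_has_vector_derivative)
    qed (use True cont in auto)
    moreover have "(\<integral>r. indicator {norm y..t} r *\<^sub>R ?w r \<partial>lborel) = (\<integral>r. ?I r \<partial>lborel)"
      using ae by (intro integral_cong_AE) auto
    moreover have ?A
      using ae int by (subst integrable_cong_AE[symmetric]) auto
    ultimately show ?thesis using True
      by (simp add: radial_kernel_def)
  qed
  then show ?A ?B by auto
qed

lemma integrable_bounded_ball:
  fixes g :: "'a::euclidean_space \<Rightarrow> real"
  assumes [measurable]: "g \<in> borel_measurable borel" and "\<And>y. norm y < r \<Longrightarrow> \<bar>g y\<bar> \<le> M"
  shows "integrable lborel (\<lambda>y. if norm y < r then g y else 0)"
proof (rule Bochner_Integration.integrable_bound)
  have "integrable lborel (\<lambda>y. M * indicator (ball 0 r :: 'a set) y)"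
    using emeasure_lborel_ball_finite by (intro integrable_mult_right integrable_real_indicator) auto
  moreover have "(\<lambda>y. M * indicator (ball 0 r :: 'a set) y) = (\<lambda>y. if norm y < r then M else 0)"
    by (auto simp: indicator_def)
  ultimately show "integrable lborel (\<lambda>y::'a. if norm y < r then M else 0)"
    by simp
  show "AE y in lborel. norm (if norm y < r then g y else 0) \<le> norm (if norm y < r then M else 0)"
    using assms(2) by (intro AE_I2) fastforce
qed auto

lemma integral_ball_scale:
  fixes h :: "'a::euclidean_space \<Rightarrow> real"
  assumes "r > 0" and [measurable]: "h \<in> borel_measurable borel"
  shows "(\<integral>y. (if norm y < r then h y else 0) \<partial>lborel)
    = r ^ DIM('a) * (\<integral>u. (if norm u < 1 then h (r *\<^sub>R u) else 0) \<partial>lborel)"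
  using assms(1)
  by (subst lborel_integral_affine[of r _ 0]) (auto intro!: Bochner_Integration.integral_cong)

text \<open>The growth bound on \<open>h\<close> makes the exchange of integrals legitimate: on the
  ball of radius r it contributes M r and the volume contributes r^n, which together cancel the
  singular layer weight n / r^(n+1). After scaling to the unit ball only n / r remains, to be
  absorbed by the linear growth of \<open>h\<close>.\<close>

lemma radial_kernel_Fubini:
  fixes h :: "'a::euclidean_space \<Rightarrow> real"
  assumes h[measurable]: "h \<in> borel_measurable borel" and bound: "\<And>y. \<bar>h y\<bar> \<le> M * norm y" 
  shows "integrable lborel (\<lambda>y. radial_kernel t y * h y)" (is ?A)
    and "(\<integral>y. radial_kernel t y * h y \<partial>lborel) =
      (\<integral>r. (if 0 < r \<and> r \<le> t then real DIM('a) / r * (\<integral>u. (if norm u < 1 then h (r *\<^sub>R u) else 0) \<partial>lborel) else 0) \<partial>lborel)" (is ?B)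
proof -
  let ?n = "DIM('a)"
  define w where "w = (\<lambda>r::real. real ?n / r ^ Suc ?n)"
  have [measurable]: "w \<in> borel_measurable borel" unfolding w_def by measurable
  define G where "G = (\<lambda>r (y::'a). if 0 < r \<and> r \<le> t \<and> norm y < r then w r * h y else 0)"
  have G[measurable]: "case_prod G \<in> borel_measurable (lborel \<Otimes>\<^sub>M lborel)"
    unfolding G_def by measurable
  \<comment> \<open>The growth bound at a vector of norm 1 shows that \<open>M\<close> is
    nonnegative.\<close>
  obtain i :: 'a where "i \<in> Basis"
    using nonempty_Basis by blast
  then have M: "M \<ge> 0"
    using order_trans[OF abs_ge_zero bound[of i]] by simp
  have hb: "\<bar>h y\<bar> \<le> M * r" if "norm y < r" for y r
    using bound[of y] mult_left_mono[OF less_imp_le[OF that] M] by linarith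
  have slice: "integrable lborel (\<lambda>y. G r y)" for r
  proof (cases "0 < r \<and> r \<le> t")
    case True
    have "integrable lborel (\<lambda>y. w r * (if norm y < r then h y else 0))"
      using hb by (intro integrable_mult_right integrable_bounded_ball) auto
    then show ?thesis
      using True by (auto simp: G_def if_distrib cong: if_cong)
  qed (auto simp: G_def)
  have int: "integrable (lborel \<Otimes>\<^sub>M lborel) (case_prod G)"
  proof (rule lborel_pair.Fubini_integrable)
    show "AE r in lborel. integrable lborel (\<lambda>y. case_prod G (r, y))"
      using slice by simp
    show "integrable lborel (\<lambda>r. \<integral>y. norm (case_prod G (r, y)) \<partial>lborel)"
    proof (rule Bochner_Integration.integrable_bound)
      \<comment> \<open>All powers of r cancel, so the norms of the slices are bounded by a constant
        on the bounded interval (0, t].\<close>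
      let ?C = "real ?n * M * measure lborel (ball (0::'a) 1)"
      show "integrable lborel (\<lambda>r. ?C * indicator {0<..t} r)"
        by (cases "0 \<le> t"; intro integrable_mult_right integrable_real_indicator) auto
      show "AE r in lborel. norm (\<integral>y. norm (case_prod G (r, y)) \<partial>lborel) \<le> norm (?C * indicator {0<..t} r)"
      proof (intro AE_I2)
        fix r
        show "norm (\<integral>y. norm (case_prod G (r, y)) \<partial>lborel) \<le> norm (?C * indicator {0<..t} r)"
        proof (cases "0 < r \<and> r \<le> t")
          case False
          then have "G r y = 0" for y by (auto simp: G_def)
          then show ?thesis by simp
        next
          case True
          have "(\<integral>y. norm (G r y) \<partial>lborel) \<le> (\<integral>y. w r * (M * r) * indicator (ball (0::'a) r) y \<partial>lborel)"
          proof (rule integral_mono)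
            show "integrable lborel (\<lambda>y. norm (G r y))" using slice by auto
            show "integrable lborel (\<lambda>y. w r * (M * r) * indicator (ball (0::'a) r) y)"
              by (intro integrable_mult_right integrable_real_indicator) (use emeasure_lborel_ball_finite in auto)
            show "norm (G r y) \<le> w r * (M * r) * indicator (ball (0::'a) r) y" for y
            proof -
              have "w r \<ge> 0" using True by (simp add: w_def)
              then show ?thesis
                using True hb[of y r] by (auto simp: G_def abs_mult intro!: mult_left_mono)
            qed
          qed
          also have "\<dots> = w r * (M * r) * measure lborel (ball (0::'a) r)"
            by simp
          also have "\<dots> = ?C"
            using True content_ball_conv_unit_ball[of r "0::'a"] by (simp add: w_def field_simps)
          finally show ?thesis
            using True M by simp
        qed
      qed
    qed simp
  qed simp
  have inner: "(\<integral>r. G r y \<partial>lborel) = radial_kernel t y * h y" for y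
  proof (cases "y = 0")
    case True
    \<comment> \<open>The layer formula fails at the origin, but the growth bound forces
      \<open>h 0 = 0\<close> there.\<close>
    then show ?thesis using bound[of 0] by (simp add: G_def cong: if_cong)
  next
    case False
    have "(\<integral>r. G r y \<partial>lborel) = (\<integral>r. (if norm y < r \<and> r \<le> t then w r else 0) * h y \<partial>lborel)"
      by (intro Bochner_Integration.integral_cong)
        (auto simp: G_def dest: order.strict_trans1[OF norm_ge_zero])
    then show ?thesis
      using radial_kernel_layers(2)[OF False, of t] by (simp add: w_def cong: if_cong)
  qed
  have "integrable lborel (\<lambda>y. \<integral>r. G r y \<partial>lborel)"
    using lborel_pair.integrable_snd[OF int] by simp
  then show ?A by (simp add: inner)
  have "(\<integral>y. radial_kernel t y * h y \<partial>lborel) = (\<integral>r. (\<integral>y. G r y \<partial>lborel) \<partial>lborel)"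
    unfolding inner[symmetric] by (rule lborel_pair.Fubini_integral[OF int])
  also have "\<dots> = (\<integral>r. (if 0 < r \<and> r \<le> t then real ?n / r * (\<integral>u. (if norm u < 1 then h (r *\<^sub>R u) else 0) \<partial>lborel) else 0) \<partial>lborel)"
  proof (rule Bochner_Integration.integral_cong[OF refl])
    fix r
    show "(\<integral>y. G r y \<partial>lborel) = (if 0 < r \<and> r \<le> t then real ?n / r * (\<integral>u. (if norm u < 1 then h (r *\<^sub>R u) else 0) \<partial>lborel) else 0)"
    proof (cases "0 < r \<and> r \<le> t")
      case True
      then have "(\<integral>y. G r y \<partial>lborel) = (\<integral>y. w r * (if norm y < r then h y else 0) \<partial>lborel)"
        by (intro Bochner_Integration.integral_cong) (auto simp: G_def)
      also have "\<dots> = w r * (r ^ ?n * (\<integral>u. (if norm u < 1 then h (r *\<^sub>R u) else 0) \<partial>lborel))"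
        using True integral_ball_scale[OF _ h, of r] by simp
      finally show ?thesis using True by (simp add: w_def field_simps)
    qed (auto simp: G_def cong: if_cong)
  qed
  finally show ?B .
qed

section \<open>Calculus of test functions and the kernel tested against them\<close>

lemma test_function_C_k: "test_function \<phi> \<Longrightarrow> C_k k \<phi>"
  by (simp add: test_function_def)

lemma test_function_has_derivative:
  "test_function \<phi> \<Longrightarrow> (\<phi> has_derivative frechet_derivative \<phi> (at x)) (at x)"
  using C_k_has_derivative test_function_C_k by blast

lemma test_function_continuous: "test_function \<phi> \<Longrightarrow> continuous_on UNIV \<phi>"
  using test_function_C_k[of \<phi> 0] by simp

lemma test_function_continuous_derivative:
  "test_function \<phi> \<Longrightarrow> i \<in> Basis \<Longrightarrow> continuous_on UNIV (\<lambda>x. frechet_derivative \<phi> (at x) i)"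
  using test_function_C_k[of \<phi> "Suc 0"] by simp

lemma test_function_translation:
  assumes "test_function \<phi>"
  shows "test_function (\<lambda>x. \<phi> (x + c))"
proof -
  have "bounded {x. \<phi> x \<noteq> 0}"
    using assms bounded_subset[OF compact_imp_bounded closure_subset] by (simp add: test_function_def)
  then have "bounded ((\<lambda>x. - c + x) ` {x. \<phi> x \<noteq> 0})"
    by (rule bounded_translation)
  moreover have "{x. \<phi> (x + c) \<noteq> 0} \<subseteq> (\<lambda>x. - c + x) ` {x. \<phi> x \<noteq> 0}"
    by (auto intro!: image_eqI[of _ _ "_ + c"])
  ultimately have "bounded {x. \<phi> (x + c) \<noteq> 0}"
    by (rule bounded_subset)
  then show ?thesis
    using assms by (simp add: test_function_def C_k_translation)
qed

lemma test_function_derivative_translation: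
  assumes "test_function \<phi>"
  shows "frechet_derivative (\<lambda>x. \<phi> (x + c)) (at x) = frechet_derivative \<phi> (at (x + c))"
  using frechet_derivative_at[OF frechet_derivative_translation, of \<phi> x c] differentiableI[OF test_function_has_derivative[OF assms]]
  by simp

text \<open>The complement of the closed support is open and \<phi> vanishes on it, hence so does
  the derivative. One radius therefore serves both.\<close>

lemma test_function_support:
  assumes "test_function \<phi>"
  obtains R where "R > 0" "\<And>x. norm x > R \<Longrightarrow> \<phi> x = 0"
    "\<And>x i. norm x > R \<Longrightarrow> frechet_derivative \<phi> (at x) i = 0"
proof -
  define S where "S = closure {x. \<phi> x \<noteq> 0}"
  have S: "bounded S" "closed S"
    using assms by (simp_all add: S_def test_function_def compact_imp_bounded)
  from S(1) obtain R where R: "R > 0" "\<And>x. x \<in> S \<Longrightarrow> norm x \<le> R"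
    unfolding bounded_pos by blast
  have zero: "\<phi> x = 0" if "x \<notin> S" for x
    using that closure_subset[of "{x. \<phi> x \<noteq> 0}"] by (auto simp: S_def)
  have derivative_zero: "frechet_derivative \<phi> (at x) i = 0" if x: "x \<notin> S" for x i
  proof -
    have "(\<phi> has_derivative (\<lambda>_. 0)) (at x)"
      by (rule has_derivative_transform_within_open[where s = "- S" and f = "\<lambda>_. 0"])
        (use x zero S(2) in auto)
    then show ?thesis
      using frechet_derivative_at by metis
  qed
  have "x \<notin> S" if "norm x > R" for x
    using R(2)[of x] that by auto
  then show thesis
    using R(1) zero derivative_zero by (intro that[of R]) auto
qed

lemma continuous_compact_support_bounded:
  fixes \<phi> :: "'a::euclidean_space \<Rightarrow> real"
  assumes "continuous_on UNIV \<phi>" "\<And>x. norm x > R \<Longrightarrow> \<phi> x = 0"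
  obtains M where "M > 0" "\<And>x. \<bar>\<phi> x\<bar> \<le> M"
proof -
  have "compact (\<phi> ` cball 0 R)"
    using assms(1) by (intro compact_continuous_image) (auto intro: continuous_on_subset)
  then obtain M where M: "M > 0" "\<And>x. norm x \<le> R \<Longrightarrow> \<bar>\<phi> x\<bar> \<le> M"
    using bounded_pos[of "\<phi> ` cball 0 R"] compact_imp_bounded by auto
  have "\<bar>\<phi> x\<bar> \<le> M" for x
    using M assms(2)[of x] by (cases "norm x \<le> R") auto
  then show thesis using that M(1) by blast
qed

lemma test_function_derivative_sum:
  assumes "test_function \<phi>"
  shows "frechet_derivative \<phi> (at x) y = (\<Sum>i\<in>Basis. (y \<bullet> i) * frechet_derivative \<phi> (at x) i)"
proof -
  interpret linear "frechet_derivative \<phi> (at x)"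
    using test_function_has_derivative[OF assms] has_derivative_linear by blast
  have "frechet_derivative \<phi> (at x) y = frechet_derivative \<phi> (at x) (\<Sum>i\<in>Basis. (y \<bullet> i) *\<^sub>R i)"
    by (simp add: euclidean_representation)
  then show ?thesis by (simp add: sum scale)
qed

text \<open>This is the growth condition of \<open>radial_kernel_Fubini\<close> for y \<mapsto>
  D\<phi>(z + y) y, uniformly in z.\<close>

lemma test_function_derivative_bound:
  fixes \<phi> :: "'a::euclidean_space \<Rightarrow> real"
  assumes "test_function \<phi>"
  obtains M where "M > 0" "\<And>x y. \<bar>frechet_derivative \<phi> (at x) y\<bar> \<le> M * norm y"
proof -
  obtain R where R: "\<And>x i. norm x > R \<Longrightarrow> frechet_derivative \<phi> (at x) i = 0"
    using test_function_support[OF assms] by metis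
  have "\<exists>M>0. \<forall>x. \<bar>frechet_derivative \<phi> (at x) i\<bar> \<le> M" if "i \<in> Basis" for i
    using continuous_compact_support_bounded[OF test_function_continuous_derivative[OF assms that] R] by blast
  then obtain B where B: "\<And>i x. i \<in> Basis \<Longrightarrow> B i > 0 \<and> \<bar>frechet_derivative \<phi> (at x) i\<bar> \<le> B i"
    by metis
  show thesis
  proof
    show "(\<Sum>i\<in>(Basis::'a set). B i) > 0"
      using B by (intro sum_pos) auto
    fix x y
    have "\<bar>frechet_derivative \<phi> (at x) y\<bar> \<le> (\<Sum>i\<in>Basis. \<bar>(y \<bullet> i) * frechet_derivative \<phi> (at x) i\<bar>)"
      unfolding test_function_derivative_sum[OF assms, of x y] by (rule sum_abs)
    also have "\<dots> \<le> (\<Sum>i\<in>Basis. norm y * B i)"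
      using B by (intro sum_mono) (auto simp: abs_mult Basis_le_norm intro!: mult_mono)
    finally show "\<bar>frechet_derivative \<phi> (at x) y\<bar> \<le> (\<Sum>i\<in>Basis. B i) * norm y"
      by (simp add: sum_distrib_left mult.commute)
  qed
qed

text \<open>Expanding the direction in the basis reduces joint continuity in point and direction to
  continuity of the partial derivatives. It supplies the measurability on product spaces that Fubini
  asks for.\<close>

lemma continuous_frechet_derivative_comp:
  assumes "test_function \<phi>"
    and "continuous_on UNIV a" "continuous_on UNIV b"
  shows "continuous_on UNIV (\<lambda>p. frechet_derivative \<phi> (at (a p)) (b p))"
proof -
  have "continuous_on UNIV (\<lambda>p. \<Sum>i\<in>Basis. (b p \<bullet> i) * frechet_derivative \<phi> (at (a p)) i)"
    by (intro continuous_on_sum continuous_on_mult continuous_on_inner continuous_on_const assms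
        continuous_on_compose2[OF test_function_continuous_derivative[OF assms(1)]]) auto
  then show ?thesis
    by (rule continuous_on_eq) (rule test_function_derivative_sum[OF assms(1), symmetric])
qed

text \<open>Linearity of the derivative in its direction produces a factor r, which cancels the 1/r
  left by \<open>radial_kernel_Fubini\<close>. The remaining integrand \<open>H\<close> is bounded
  on \<open>{0<..t} \<times> ball 0 1\<close>, so the integrals can be exchanged a second time, and
  for fixed u the fundamental theorem of calculus applies along the ray r \<mapsto> z + r u.\<close>

lemma radial_kernel_derivative:
  fixes \<phi> :: "'a::euclidean_space \<Rightarrow> real"
  assumes \<phi>: "test_function \<phi>" and t: "t > 0"
  shows "(\<integral>y. radial_kernel t y * frechet_derivative \<phi> (at (z + y)) y \<partial>lborel) =
    real DIM('a) * ((\<integral>u. (if norm u < 1 then \<phi> (z + t *\<^sub>R u) else 0) \<partial>lborel) - measure lborel (ball (0::'a) 1) * \<phi> z)"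
proof -
  let ?D = "\<lambda>x. frechet_derivative \<phi> (at x)"
  obtain M where M: "M > 0" "\<And>x y. \<bar>?D x y\<bar> \<le> M * norm y"
    using that by (rule test_function_derivative_bound[OF \<phi>])
  have \<phi>c: "continuous_on UNIV \<phi>" by (rule test_function_continuous[OF \<phi>])
  then have [measurable]: "\<phi> \<in> borel_measurable borel"
    by (rule borel_measurable_continuous_onI)
  obtain R where R: "\<And>x. norm x > R \<Longrightarrow> \<phi> x = 0"
    using test_function_support[OF \<phi>] by metis
  obtain B where B: "\<And>x. \<bar>\<phi> x\<bar> \<le> B"
    using continuous_compact_support_bounded[OF \<phi>c R] by (metis (no_types))
  have D1[measurable]: "(\<lambda>y. ?D (z + y) y) \<in> borel_measurable borel"
    by (intro borel_measurable_continuous_onI continuous_frechet_derivative_comp[OF \<phi>] continuous_intros)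
  have D2: "continuous_on UNIV (\<lambda>p::real \<times> 'a. ?D (z + fst p *\<^sub>R snd p) (snd p))"
    by (intro continuous_frechet_derivative_comp[OF \<phi>] continuous_intros)
  then have [measurable]: "(\<lambda>p::real \<times> 'a. ?D (z + fst p *\<^sub>R snd p) (snd p)) \<in> borel_measurable (lborel \<Otimes>\<^sub>M lborel)"
    using borel_measurable_continuous_onI by (simp add: lborel_prod)
  define H where "H = (\<lambda>r (u::'a). if 0 < r \<and> r \<le> t \<and> norm u < 1 then ?D (z + r *\<^sub>R u) u else 0)"
  have H: "case_prod H = (\<lambda>p. if 0 < fst p \<and> fst p \<le> t \<and> norm (snd p) < 1 then ?D (z + fst p *\<^sub>R snd p) (snd p) else 0)"
    by (auto simp: H_def)
  have H_measurable: "case_prod H \<in> borel_measurable (lborel \<Otimes>\<^sub>M lborel)"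
    unfolding H by measurable
  have int: "integrable (lborel \<Otimes>\<^sub>M lborel) (case_prod H)"
  proof (rule Bochner_Integration.integrable_bound)
    show "integrable (lborel \<Otimes>\<^sub>M lborel) (\<lambda>p. M * indicator ({0<..t} \<times> ball (0::'a) 1) p)"
      using t emeasure_lborel_ball_finite[of "0::'a" 1]
      by (intro integrable_mult_right integrable_real_indicator)
        (auto simp: lborel.emeasure_pair_measure_Times ennreal_mult_less_top)
    show "AE p in lborel \<Otimes>\<^sub>M lborel. norm (case_prod H p) \<le> norm (M * indicator ({0<..t} \<times> ball (0::'a) 1) p)"
    proof (intro AE_I2)
      fix p :: "real \<times> 'a"
      have "\<bar>?D x (snd p)\<bar> \<le> M" if "norm (snd p) < 1" for x
        using M(1) that by (intro order_trans[OF M(2)]) (simp add: mult_left_le)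
      then show "norm (case_prod H p) \<le> norm (M * indicator ({0<..t} \<times> ball (0::'a) 1) p)"
        using M(1) by (simp add: H indicator_def mem_Times_iff)
    qed
  qed (rule H_measurable)
  have inner: "(\<integral>r. H r u \<partial>lborel) = (if norm u < 1 then \<phi> (z + t *\<^sub>R u) - \<phi> z else 0)" for u
  proof (cases "norm u < 1")
    case True
    have c: "continuous_on UNIV (\<lambda>r. ?D (z + r *\<^sub>R u) u)"
      by (intro continuous_frechet_derivative_comp[OF \<phi>] continuous_intros)
    have "(\<integral>r. indicator {0..t} r *\<^sub>R ?D (z + r *\<^sub>R u) u \<partial>lborel) = \<phi> (z + t *\<^sub>R u) - \<phi> (z + 0 *\<^sub>R u)"
    proof (rule integral_FTC_atLeastAtMost)
      fix r
      have "((\<lambda>r. z + r *\<^sub>R u) has_derivative (\<lambda>h. h *\<^sub>R u)) (at r within {0..t})"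
        by (auto intro!: derivative_eq_intros)
      from has_derivative_compose[OF this test_function_has_derivative[OF \<phi>]]
      have "((\<lambda>r. \<phi> (z + r *\<^sub>R u)) has_derivative (\<lambda>h. ?D (z + r *\<^sub>R u) (h *\<^sub>R u))) (at r within {0..t})" .
      then show "((\<lambda>r. \<phi> (z + r *\<^sub>R u)) has_vector_derivative ?D (z + r *\<^sub>R u) u) (at r within {0..t})"
        using linear_scale[OF has_derivative_linear[OF test_function_has_derivative[OF \<phi>]]]
        by (simp add: has_vector_derivative_def)
    qed (use t c in \<open>auto intro: continuous_on_subset\<close>)
    moreover have "(\<integral>r. indicator {0..t} r *\<^sub>R ?D (z + r *\<^sub>R u) u \<partial>lborel) = (\<integral>r. H r u \<partial>lborel)"
    proof (rule integral_cong_AE)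
      have [measurable]: "(\<lambda>r. ?D (z + r *\<^sub>R u) u) \<in> borel_measurable borel"
        using c by (rule borel_measurable_continuous_onI)
      show "(\<lambda>r. indicator {0..t} r *\<^sub>R ?D (z + r *\<^sub>R u) u) \<in> borel_measurable lborel" by measurable
      show "(\<lambda>r. H r u) \<in> borel_measurable lborel"
        unfolding H_def by measurable
      show "AE r in lborel. indicator {0..t} r *\<^sub>R ?D (z + r *\<^sub>R u) u = H r u"
        using AE_lborel_singleton[of 0] by eventually_elim (use True in \<open>auto simp: H_def indicator_def\<close>)
    qed
    ultimately show ?thesis using True by simp
  qed (simp add: H_def)
  have "(\<integral>y. radial_kernel t y * ?D (z + y) y \<partial>lborel) =
      (\<integral>r. (if 0 < r \<and> r \<le> t then real DIM('a) / r * (\<integral>u. (if norm u < 1 then ?D (z + r *\<^sub>R u) (r *\<^sub>R u) else 0) \<partial>lborel) else 0) \<partial>lborel)"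
    by (rule radial_kernel_Fubini(2)[OF D1 M(2)])
  also have "\<dots> = (\<integral>r. real DIM('a) * (\<integral>u. H r u \<partial>lborel) \<partial>lborel)"
  proof (rule Bochner_Integration.integral_cong[OF refl])
    fix r
    show "(if 0 < r \<and> r \<le> t then real DIM('a) / r * (\<integral>u. (if norm u < 1 then ?D (z + r *\<^sub>R u) (r *\<^sub>R u) else 0) \<partial>lborel) else 0)
        = real DIM('a) * (\<integral>u. H r u \<partial>lborel)"
    proof (cases "0 < r \<and> r \<le> t")
      case True
      then have "(\<lambda>u. if norm u < 1 then ?D (z + r *\<^sub>R u) (r *\<^sub>R u) else 0) = (\<lambda>u. r * H r u)"
        using linear_scale[OF has_derivative_linear[OF test_function_has_derivative[OF \<phi>]]]
        by (auto simp: H_def)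
      then show ?thesis using True by simp
    qed (auto simp: H_def cong: if_cong)
  qed
  also have "\<dots> = real DIM('a) * (\<integral>u. (\<integral>r. H r u \<partial>lborel) \<partial>lborel)"
    using lborel_pair.Fubini_integral[OF int] by simp
  also have "(\<integral>u. (\<integral>r. H r u \<partial>lborel) \<partial>lborel) =
      (\<integral>u. (if norm u < 1 then \<phi> (z + t *\<^sub>R u) else 0) - (if norm u < 1 then \<phi> z else 0) \<partial>lborel)"
    unfolding inner by (intro Bochner_Integration.integral_cong) auto
  also have "\<dots> = (\<integral>u. (if norm u < 1 then \<phi> (z + t *\<^sub>R u) else 0) \<partial>lborel) - (\<integral>u. (if norm (u::'a) < 1 then \<phi> z else 0) \<partial>lborel)"
    using B by (intro Bochner_Integration.integral_diff integrable_bounded_ball) auto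
  also have "(\<integral>u. (if norm (u::'a) < 1 then \<phi> z else 0) \<partial>lborel) = (\<integral>u. indicator (ball (0::'a) 1) u * \<phi> z \<partial>lborel)"
    by (intro Bochner_Integration.integral_cong) (auto simp: indicator_def)
  also have "\<dots> = measure lborel (ball (0::'a) 1) * \<phi> z"
    by simp
  finally show ?thesis .
qed

section \<open>Convolution and the identity at a fixed radius\<close>

definition convolution :: "('a::euclidean_space \<Rightarrow> real) \<Rightarrow> ('a \<Rightarrow> real) \<Rightarrow> 'a \<Rightarrow> real" where
  "convolution k g x = (\<integral>y. k y * g (x - y) \<partial>lborel)"

text \<open>Fubini is applied on the product of two copies of \<^const>\<open>lborel\<close>, which is not complete, so Borel
  representatives of locally integrable functions are used throughout.\<close>

definition ball_integrable :: "('a::euclidean_space \<Rightarrow> real) \<Rightarrow> bool" where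
  "ball_integrable g \<longleftrightarrow> g \<in> borel_measurable borel \<and>
     (\<forall>R. integrable lborel (\<lambda>x. indicator (cball 0 R) x * g x))"

text \<open>If neither \<open>k y\<close> nor \<open>\<phi> (z + y)\<close> vanishes then
  \<open>norm z \<le> R + T\<close>, so only the restriction of \<open>g\<close> to one ball
  matters. In the variables (y, z) the majorant is a product; the variables (y, x) follow by
  translating each slice. \<open>\<phi>\<close> is merely bounded and Borel so that partial
  derivatives and indicators of balls qualify too.\<close>

lemma convolution_Fubini:
  fixes k g \<phi> :: "'a::euclidean_space \<Rightarrow> real"
  assumes k: "integrable lborel k" "\<And>y. norm y > T \<Longrightarrow> k y = 0"
    and g: "ball_integrable g"
    and \<phi>[measurable]: "\<phi> \<in> borel_measurable borel"
    and M: "\<And>x. \<bar>\<phi> x\<bar> \<le> M" and R: "\<And>x. norm x > R \<Longrightarrow> \<phi> x = 0"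
  shows "integrable (lborel \<Otimes>\<^sub>M lborel) (\<lambda>(y, z). k y * (\<phi> (z + y) * g z))" (is ?A)
    and "integrable (lborel \<Otimes>\<^sub>M lborel) (\<lambda>(y, x). k y * (\<phi> x * g (x - y)))" (is ?B)
proof -
  have [measurable]: "k \<in> borel_measurable borel" "g \<in> borel_measurable borel"
    using k g by (auto simp: ball_integrable_def)
  let ?F = "\<lambda>y z. k y * (\<phi> (z + y) * g z)"
  let ?E = "\<lambda>y x. k y * (\<phi> x * g (x - y))"
  let ?g = "\<lambda>z. \<bar>indicator (cball 0 (R + T)) z * g z\<bar>"
  let ?C = "\<integral>z. ?g z \<partial>lborel"
  have gi: "integrable lborel ?g"
    using g by (auto simp: ball_integrable_def)
  have bound: "\<bar>?F y z\<bar> \<le> \<bar>k y\<bar> * (M * ?g z)" for y z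
  proof (cases "norm y \<le> T \<and> norm (z + y) \<le> R")
    case True
    have "norm z \<le> norm (z + y) + norm y"
      using norm_triangle_ineq4[of "z + y" y] by simp
    then have "norm z \<le> R + T" using True by simp
    then show ?thesis
      using M[of "z + y"] by (auto simp: abs_mult intro!: mult_mono)
  next
    case False
    then have "?F y z = 0"
      using k(2)[of y] R[of "z + y"] by (auto simp: not_le)
    moreover have "0 \<le> \<bar>k y\<bar> * (M * ?g z)"
      using order_trans[OF abs_ge_zero M] by (intro mult_nonneg_nonneg) auto
    ultimately show ?thesis by linarith
  qed
  have F_slice: "integrable lborel (\<lambda>z. ?F y z)" for y
  proof (rule Bochner_Integration.integrable_bound)
    show "integrable lborel (\<lambda>z. \<bar>k y\<bar> * (M * ?g z))"
      using gi by simp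
    show "AE z in lborel. norm (?F y z) \<le> norm (\<bar>k y\<bar> * (M * ?g z))"
      using order_trans[OF bound abs_ge_self] by (intro AE_I2) (simp only: real_norm_def)
  qed measurable
  have F_int: "integrable lborel (\<lambda>y. \<integral>z. norm (?F y z) \<partial>lborel)"
  proof (rule Bochner_Integration.integrable_bound)
    show "integrable lborel (\<lambda>y. \<bar>k y\<bar> * (M * ?C))"
      using k by simp
    show "AE y in lborel. norm (\<integral>z. norm (?F y z) \<partial>lborel) \<le> norm (\<bar>k y\<bar> * (M * ?C))"
    proof (intro AE_I2)
      fix y
      have "(\<integral>z. norm (?F y z) \<partial>lborel) \<le> (\<integral>z. \<bar>k y\<bar> * (M * ?g z) \<partial>lborel)"
      proof (rule integral_mono)
        show "integrable lborel (\<lambda>z. norm (?F y z))"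
          by (rule integrable_norm[OF F_slice])
        show "integrable lborel (\<lambda>z. \<bar>k y\<bar> * (M * ?g z))"
          using gi by simp
        show "norm (?F y z) \<le> \<bar>k y\<bar> * (M * ?g z)" for z
          using bound by (simp only: real_norm_def)
      qed
      also have "\<dots> = \<bar>k y\<bar> * (M * ?C)"
        by simp
      finally have "(\<integral>z. norm (?F y z) \<partial>lborel) \<le> \<bar>k y\<bar> * (M * ?C)" .
      moreover have "0 \<le> (\<integral>z. norm (?F y z) \<partial>lborel)"
        by (intro Bochner_Integration.integral_nonneg) simp
      ultimately show "norm (\<integral>z. norm (?F y z) \<partial>lborel) \<le> norm (\<bar>k y\<bar> * (M * ?C))"
        unfolding real_norm_def by linarith
    qed
  qed measurable
  show ?A
    by (rule lborel_pair.Fubini_integrable) (use F_slice F_int in auto)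
  have E_slice: "integrable lborel (\<lambda>x. ?E y x)" for y
    using lborel_integrable_affine[OF _ F_slice[of y], of 1 "- y"] by (simp add: algebra_simps)
  have "(\<integral>x. norm (?E y x) \<partial>lborel) = (\<integral>z. norm (?F y z) \<partial>lborel)" for y
    using lborel_integral_affine[of 1 "\<lambda>z. norm (?F y z)" "- y"] by (simp add: algebra_simps)
  then show ?B
    using E_slice F_int by (intro lborel_pair.Fubini_integrable) auto
qed

text \<open>Duality moves the convolution onto \<open>\<phi>\<close>. The intermediate expression
  with y outermost is kept because integration by parts happens there, in z for fixed y: the first
  half of the chain is applied to a component of the gradient, the second half to the function
  itself.\<close>

lemma integral_convolution:
  fixes k g \<phi> :: "'a::euclidean_space \<Rightarrow> real"
  assumes "integrable lborel k" "\<And>y. norm y > T \<Longrightarrow> k y = 0"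
    and "ball_integrable g"
    and "\<phi> \<in> borel_measurable borel" "\<And>x. \<bar>\<phi> x\<bar> \<le> M" "\<And>x. norm x > R \<Longrightarrow> \<phi> x = 0"
  shows "integrable lborel (\<lambda>x. \<phi> x * convolution k g x)"
    and "(\<integral>x. \<phi> x * convolution k g x \<partial>lborel) = (\<integral>y. k y * (\<integral>z. \<phi> (z + y) * g z \<partial>lborel) \<partial>lborel)"
    and "(\<integral>y. k y * (\<integral>z. \<phi> (z + y) * g z \<partial>lborel) \<partial>lborel) = (\<integral>z. g z * (\<integral>y. k y * \<phi> (z + y) \<partial>lborel) \<partial>lborel)"
    and "integrable lborel (\<lambda>z. g z * (\<integral>y. k y * \<phi> (z + y) \<partial>lborel))"
proof -
  have [measurable]: "k \<in> borel_measurable borel" "g \<in> borel_measurable borel" "\<phi> \<in> borel_measurable borel"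
    using assms by (auto simp: ball_integrable_def)
  note F = convolution_Fubini(1)[OF assms] and E = convolution_Fubini(2)[OF assms]
  have 1: "(\<integral>y. k y * (\<phi> x * g (x - y)) \<partial>lborel) = \<phi> x * convolution k g x" for x
    by (simp add: convolution_def mult.left_commute flip: integral_mult_right_zero)
  have 2: "(\<integral>x. k y * (\<phi> x * g (x - y)) \<partial>lborel) = k y * (\<integral>z. \<phi> (z + y) * g z \<partial>lborel)" for y
    using lborel_integral_affine[of 1 "\<lambda>x. k y * (\<phi> x * g (x - y))" y] by (simp add: add.commute)
  have 3: "(\<integral>y. k y * (\<phi> (z + y) * g z) \<partial>lborel) = g z * (\<integral>y. k y * \<phi> (z + y) \<partial>lborel)" for z
    by (simp add: mult_ac flip: integral_mult_right_zero)
  show "integrable lborel (\<lambda>x. \<phi> x * convolution k g x)"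
    using lborel_pair.integrable_snd[OF E] by (simp add: 1)
  show "(\<integral>x. \<phi> x * convolution k g x \<partial>lborel) = (\<integral>y. k y * (\<integral>z. \<phi> (z + y) * g z \<partial>lborel) \<partial>lborel)"
    using lborel_pair.Fubini_integral[OF E] by (simp only: 1 2)
  show "(\<integral>y. k y * (\<integral>z. \<phi> (z + y) * g z \<partial>lborel) \<partial>lborel) = (\<integral>z. g z * (\<integral>y. k y * \<phi> (z + y) \<partial>lborel) \<partial>lborel)"
    using lborel_pair.Fubini_integral[OF F] by (simp add: 3)
  show "integrable lborel (\<lambda>z. g z * (\<integral>y. k y * \<phi> (z + y) \<partial>lborel))"
    using lborel_pair.integrable_snd[OF F] by (simp add: 3)
qed

text \<open>Fubini needs a cutoff in x. The indicators of balls of integer radius give countably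
  many exceptional null sets, and at a given x a large enough cutoff equals 1.\<close>

lemma AE_integrable_convolution:
  fixes k g :: "'a::euclidean_space \<Rightarrow> real"
  assumes k: "integrable lborel k" "\<And>y. norm y > T \<Longrightarrow> k y = 0" and g: "ball_integrable g"
  shows "AE x in lborel. integrable lborel (\<lambda>y. k y * g (x - y))"
proof -
  have "AE x in lborel. integrable lborel (\<lambda>y. k y * (indicator (cball 0 (real m)) x * g (x - y)))" for m
  proof -
    have "integrable (lborel \<Otimes>\<^sub>M lborel) (\<lambda>(y, x). k y * (indicator (cball 0 (real m)) x * g (x - y)))"
      by (rule convolution_Fubini(2)[OF k g, where M = 1 and R = "real m"]) (auto simp: indicator_def)
    then show ?thesis
      by (intro lborel_pair.AE_integrable_snd) simp
  qed
  then have "AE x in lborel. \<forall>m. integrable lborel (\<lambda>y. k y * (indicator (cball 0 (real m)) x * g (x - y)))"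
    by (simp add: AE_all_countable)
  then show ?thesis
  proof eventually_elim
    case (elim x)
    obtain m where "norm x \<le> real m"
      using real_arch_simple by blast
    then show ?case
      using elim[rule_format, of m] by simp
  qed
qed

lemma ball_integrable_convolution:
  fixes k g :: "'a::euclidean_space \<Rightarrow> real"
  assumes k: "integrable lborel k" "\<And>y. norm y > T \<Longrightarrow> k y = 0" and g: "ball_integrable g"
  shows "ball_integrable (convolution k g)"
  unfolding ball_integrable_def
proof (intro conjI allI)
  have [measurable]: "k \<in> borel_measurable borel" "g \<in> borel_measurable borel"
    using k g by (auto simp: ball_integrable_def)
  show "convolution k g \<in> borel_measurable borel"
    unfolding convolution_def by measurable
  show "integrable lborel (\<lambda>x. indicator (cball 0 R) x * convolution k g x)" for R
    by (rule integral_convolution(1)[OF k g, where M = 1 and R = R]) (auto simp: indicator_def)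
qed

lemma ball_integrable_set_integrable:
  assumes "ball_integrable g" "compact K"
  shows "set_integrable lborel K g"
proof -
  obtain R where "\<And>x. x \<in> K \<Longrightarrow> norm x \<le> R"
    using compact_imp_bounded[OF assms(2)] unfolding bounded_iff by blast
  then have "K \<subseteq> cball 0 R"
    by auto
  moreover have "set_integrable lborel (cball 0 R) g"
    using assms by (simp add: ball_integrable_def set_integrable_def)
  moreover have "K \<in> sets lborel"
    using compact_imp_closed[OF assms(2)] by simp
  ultimately show ?thesis
    using set_integrable_subset by blast
qed

lemma ball_integrable_mult_right: "ball_integrable g \<Longrightarrow> ball_integrable (\<lambda>x. c * g x)"
  unfolding ball_integrable_def by (auto simp: mult.left_commute[of _ c])

lemma ball_integrable_diff: "ball_integrable f \<Longrightarrow> ball_integrable g \<Longrightarrow> ball_integrable (\<lambda>x. f x - g x)"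
  unfolding ball_integrable_def by (auto simp: right_diff_distrib)

lemma ball_integrable_sum:
  "(\<And>i. i \<in> A \<Longrightarrow> ball_integrable (g i)) \<Longrightarrow> ball_integrable (\<lambda>x. \<Sum>i\<in>A. g i x)"
  unfolding ball_integrable_def sum_distrib_left
  by (auto intro!: borel_measurable_sum Bochner_Integration.integrable_sum)

lemma ball_integrable_abs:
  assumes "ball_integrable g"
  shows "ball_integrable (\<lambda>x. \<bar>g x\<bar>)"
proof -
  have "integrable lborel (\<lambda>x. \<bar>indicator (cball 0 R) x * g x\<bar>)" for R
    using assms by (simp only: ball_integrable_def integrable_abs)
  then show ?thesis
    using assms by (auto simp: ball_integrable_def abs_mult)
qed

lemma ball_integrable_test_mult:
  fixes \<phi> :: "'a::euclidean_space \<Rightarrow> real"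
  assumes "ball_integrable g" and c: "continuous_on UNIV \<phi>" and R: "\<And>x. norm x > R \<Longrightarrow> \<phi> x = 0"
  shows "integrable lborel (\<lambda>x. \<phi> x * g x)"
proof -
  obtain M where M: "M > 0" "\<And>x. \<bar>\<phi> x\<bar> \<le> M"
    using continuous_compact_support_bounded[OF c R] by metis
  have [measurable]: "\<phi> \<in> borel_measurable borel" "g \<in> borel_measurable borel"
    using c assms(1) by (auto simp: ball_integrable_def intro: borel_measurable_continuous_onI)
  show ?thesis
  proof (rule Bochner_Integration.integrable_bound)
    show "integrable lborel (\<lambda>x. M * (indicator (cball 0 R) x * g x))"
      using assms(1) by (simp add: ball_integrable_def)
    show "AE x in lborel. norm (\<phi> x * g x) \<le> norm (M * (indicator (cball 0 R) x * g x))"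
    proof (intro AE_I2)
      fix x
      show "norm (\<phi> x * g x) \<le> norm (M * (indicator (cball 0 R) x * g x))"
        using M(1) M(2)[of x] R[of x] by (cases "norm x \<le> R") (auto simp: abs_mult intro!: mult_right_mono)
    qed
  qed measurable
qed

lemma radial_kernel_eq_0: "norm y \<ge> t \<Longrightarrow> radial_kernel t y = 0"
  by (simp add: radial_kernel_def)

lemma integrable_radial_kernel_norm:
  "integrable lborel (\<lambda>y::'a::euclidean_space. radial_kernel t y * norm y)"
  by (rule radial_kernel_Fubini(1)[where M = 1]) auto

lemma integrable_radial_kernel_inner:
  "integrable lborel (\<lambda>y::'a::euclidean_space. radial_kernel t y * (y \<bullet> i))"
  by (rule radial_kernel_Fubini(1)[where M = "norm i"])
    (auto simp: Cauchy_Schwarz_ineq2 mult.commute[of "norm i"])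

lemma integrable_indicator_ball: "integrable lborel (indicator (ball 0 t) :: 'a::euclidean_space \<Rightarrow> real)"
  using emeasure_lborel_ball_finite[of "0::'a" t] by (intro integrable_real_indicator) auto

text \<open>\<open>radial_kernel t y *\<^sub>R y\<close> has distributional divergence proportional to the Dirac measure at the
  origin minus the uniform probability measure of the ball; \<open>radial_kernel_derivative\<close> is that fact
  tested against \<open>\<phi>\<close>, and integrating by parts gives the identity in the weak sense.\<close>

lemma AE_radial_convolution:
  fixes f :: "'a::euclidean_space \<Rightarrow> real" and G :: "'a \<Rightarrow> 'a"
  assumes f: "ball_integrable f" and G: "\<And>i. i \<in> Basis \<Longrightarrow> ball_integrable (\<lambda>x. G x \<bullet> i)"
    and weak: "\<And>\<phi> i. test_function \<phi> \<Longrightarrow> i \<in> Basis \<Longrightarrow>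
      (\<integral>x. f x * frechet_derivative \<phi> (at x) i \<partial>lborel) = - (\<integral>x. (G x \<bullet> i) * \<phi> x \<partial>lborel)"
    and t: "t > 0"
  shows "AE x in lborel. (\<Sum>i\<in>Basis. convolution (\<lambda>y. radial_kernel t y * (y \<bullet> i)) (\<lambda>x. G x \<bullet> i) x) =
    real DIM('a) * (measure lborel (ball (0::'a) 1) * f x - convolution (indicator (ball 0 t)) f x / t ^ DIM('a))"
proof -
  define n where "n = real DIM('a)"
  define \<omega> where "\<omega> = measure lborel (ball (0::'a) 1)"
  define K where "K = (\<lambda>i (y::'a). radial_kernel t y * (y \<bullet> i))"
  define J where "J = (\<lambda>x. \<Sum>i\<in>Basis. convolution (K i) (\<lambda>x. G x \<bullet> i) x)"
  define A where "A = convolution (indicator (ball 0 t)) f"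
  have Ki: "integrable lborel (K i)" for i
    unfolding K_def by (rule integrable_radial_kernel_inner)
  have Ks: "K i y = 0" if "norm y > t" for i y
    using that by (simp add: K_def radial_kernel_eq_0)
  have Bi: "integrable lborel (indicator (ball 0 t) :: 'a \<Rightarrow> real)"
    by (rule integrable_indicator_ball)
  have Bs: "indicator (ball 0 t) y = (0::real)" if "norm y > t" for y :: 'a
    using that by simp
  have J: "ball_integrable J"
    unfolding J_def by (intro ball_integrable_sum ball_integrable_convolution[OF Ki Ks] G)
  have A: "ball_integrable A"
    unfolding A_def by (intro ball_integrable_convolution[OF Bi Bs] f)
  let ?N = "\<lambda>x. J x - n * (\<omega> * f x - 1 / t ^ DIM('a) * A x)"
  have N: "ball_integrable ?N"
    by (intro ball_integrable_diff ball_integrable_mult_right J A f)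
  have "AE x in lborel. ?N x = 0"
  proof (rule AE_eq_0_if_test_integrals_eq_0)
    show "?N \<in> borel_measurable borel" using N by (simp add: ball_integrable_def)
    show "set_integrable lborel C ?N" if "compact C" for C
      by (rule ball_integrable_set_integrable[OF N that])
    fix \<phi> :: "'a \<Rightarrow> real" assume \<phi>: "test_function \<phi>"
    let ?D = "\<lambda>x i. frechet_derivative \<phi> (at x) i"
    obtain R where R: "\<And>x. norm x > R \<Longrightarrow> \<phi> x = 0" "\<And>x i. norm x > R \<Longrightarrow> ?D x i = 0"
      using test_function_support[OF \<phi>] by (metis (no_types, lifting))
    note \<phi>c = test_function_continuous[OF \<phi>]
    note Dc = test_function_continuous_derivative[OF \<phi>]
    have \<phi>m: "\<phi> \<in> borel_measurable borel" by (rule borel_measurable_continuous_onI[OF \<phi>c])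
    have Dm: "(\<lambda>x. ?D x i) \<in> borel_measurable borel" if "i \<in> Basis" for i
      by (rule borel_measurable_continuous_onI[OF Dc[OF that]])
    obtain M where M: "\<And>x. \<bar>\<phi> x\<bar> \<le> M"
      using continuous_compact_support_bounded[OF \<phi>c R(1)] by metis
    obtain B where B: "\<And>x y. \<bar>?D x y\<bar> \<le> B * norm y"
      using that by (rule test_function_derivative_bound[OF \<phi>])
    have DB: "\<bar>?D x i\<bar> \<le> B" if "i \<in> Basis" for x i
      using B[of x i] that by simp
    \<comment> \<open>The weak derivative is tested with the translate of \<open>\<phi>\<close> by
      y, whose derivative is the translate of the derivative.\<close>
    have parts: "(\<integral>z. \<phi> (z + y) * (G z \<bullet> i) \<partial>lborel) = - (\<integral>z. ?D (z + y) i * f z \<partial>lborel)" if "i \<in> Basis" for i y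
      using weak[OF test_function_translation[OF \<phi>, of y] that]
      by (simp add: test_function_derivative_translation[OF \<phi>] mult.commute)
    have J_i: "(\<integral>x. \<phi> x * convolution (K i) (\<lambda>x. G x \<bullet> i) x \<partial>lborel) =
        - (\<integral>z. f z * (\<integral>y. K i y * ?D (z + y) i \<partial>lborel) \<partial>lborel)" if i: "i \<in> Basis" for i
      using integral_convolution(2)[OF Ki Ks G[OF i] \<phi>m M R(1)]
        integral_convolution(3)[OF Ki Ks f Dm[OF i] DB[OF i] R(2)]
      by (simp add: parts[OF i])
    \<comment> \<open>Summation over the basis reassembles D\<phi>(z + y) y, to which
      \<open>radial_kernel_derivative\<close> applies. \<open>avg\<close> is divided by t^n only, so
      it is the volume of the unit ball times the mean; as an integral over \<open>ball 0 t\<close>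
      it can be moved back onto \<open>f\<close> in \<open>A_eq\<close>.\<close>
    have D_sum: "(\<Sum>i\<in>Basis. \<integral>y. K i y * ?D (z + y) i \<partial>lborel) = n * (avg - \<omega> * \<phi> z)"
      if "avg = (\<integral>y. indicator (ball 0 t) y * \<phi> (z + y) \<partial>lborel) / t ^ DIM('a)" for z avg
    proof -
      have "integrable lborel (\<lambda>y. K i y * ?D (z + y) i)" if i: "i \<in> Basis" for i
      proof (rule Bochner_Integration.integrable_bound)
        have [measurable]: "(\<lambda>x. ?D x i) \<in> borel_measurable borel" "K i \<in> borel_measurable borel"
          using Dm[OF i] Ki[of i] by auto
        show "integrable lborel (\<lambda>y. B * K i y)" using Ki by simp
        show "AE y in lborel. norm (K i y * ?D (z + y) i) \<le> norm (B * K i y)"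
        proof (intro AE_I2)
          fix y
          have "\<bar>?D (z + y) i\<bar> \<le> \<bar>B\<bar>" using DB[OF i, of "z + y"] by linarith
          then show "norm (K i y * ?D (z + y) i) \<le> norm (B * K i y)"
            by (simp add: abs_mult mult.commute[of "\<bar>B\<bar>"] mult_left_mono)
        qed
        have "(\<lambda>y. ?D (z + y) i) \<in> borel_measurable borel"
          using measurable_compose[of "\<lambda>y. z + y" borel borel "\<lambda>x. ?D x i"] by simp
        then show "(\<lambda>y. K i y * ?D (z + y) i) \<in> borel_measurable lborel"
          by simp
      qed
      then have "(\<Sum>i\<in>Basis. \<integral>y. K i y * ?D (z + y) i \<partial>lborel) = (\<integral>y. (\<Sum>i\<in>Basis. K i y * ?D (z + y) i) \<partial>lborel)"
        by (simp add: Bochner_Integration.integral_sum)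
      also have "(\<lambda>y. \<Sum>i\<in>Basis. K i y * ?D (z + y) i) = (\<lambda>y. radial_kernel t y * ?D (z + y) y)"
      proof
        fix y
        show "(\<Sum>i\<in>Basis. K i y * ?D (z + y) i) = radial_kernel t y * ?D (z + y) y"
          unfolding test_function_derivative_sum[OF \<phi>, of "z + y" y] K_def
          by (simp add: sum_distrib_left mult.assoc)
      qed
      also have "(\<integral>y. radial_kernel t y * ?D (z + y) y \<partial>lborel) =
          n * ((\<integral>u. (if norm u < 1 then \<phi> (z + t *\<^sub>R u) else 0) \<partial>lborel) - \<omega> * \<phi> z)"
        unfolding n_def \<omega>_def by (rule radial_kernel_derivative[OF \<phi> t])
      also have "(\<integral>u. (if norm u < 1 then \<phi> (z + t *\<^sub>R u) else 0) \<partial>lborel) = avg"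
      proof -
        have "(\<integral>y. indicator (ball 0 t) y * \<phi> (z + y) \<partial>lborel) = (\<integral>y. (if norm y < t then \<phi> (z + y) else 0) \<partial>lborel)"
          by (intro Bochner_Integration.integral_cong) (auto simp: indicator_def)
        also have "\<dots> = t ^ DIM('a) * (\<integral>u. (if norm u < 1 then \<phi> (z + t *\<^sub>R u) else 0) \<partial>lborel)"
          using t \<phi>m by (intro integral_ball_scale[of t "\<lambda>y. \<phi> (z + y)"]) auto
        finally show ?thesis using t that by simp
      qed
      finally show ?thesis .
    qed
    have i1: "integrable lborel (\<lambda>x. \<phi> x * convolution (K i) (\<lambda>x. G x \<bullet> i) x)" if "i \<in> Basis" for i
      by (rule integral_convolution(1)[OF Ki Ks G[OF that] \<phi>m M R(1)])
    have i2: "integrable lborel (\<lambda>x. f x * (\<integral>y. K i y * ?D (x + y) i \<partial>lborel))" if "i \<in> Basis" for i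
      by (rule integral_convolution(4)[OF Ki Ks f Dm[OF that] DB[OF that] R(2)])
    have i3: "integrable lborel (\<lambda>x. f x * (\<integral>y. indicator (ball 0 t) y * \<phi> (x + y) \<partial>lborel))"
      by (rule integral_convolution(4)[OF Bi Bs f \<phi>m M R(1)])
    have i4: "integrable lborel (\<lambda>x. \<phi> x * f x)"
      by (rule ball_integrable_test_mult[OF f \<phi>c R(1)])
    have i5: "integrable lborel (\<lambda>x. \<phi> x * A x)"
      by (rule ball_integrable_test_mult[OF A \<phi>c R(1)])
    have i6: "integrable lborel (\<lambda>x. \<phi> x * J x)"
      by (rule ball_integrable_test_mult[OF J \<phi>c R(1)])
    have A_eq: "(\<integral>x. f x * (\<integral>y. indicator (ball 0 t) y * \<phi> (x + y) \<partial>lborel) \<partial>lborel) = (\<integral>x. \<phi> x * A x \<partial>lborel)"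
      unfolding A_def using integral_convolution(2,3)[OF Bi Bs f \<phi>m M R(1)] by simp
    have "(\<integral>x. \<phi> x * J x \<partial>lborel) = (\<Sum>i\<in>Basis. \<integral>x. \<phi> x * convolution (K i) (\<lambda>x. G x \<bullet> i) x \<partial>lborel)"
      unfolding J_def sum_distrib_left using i1 by (rule Bochner_Integration.integral_sum)
    also have "\<dots> = - (\<Sum>i\<in>Basis. \<integral>x. f x * (\<integral>y. K i y * ?D (x + y) i \<partial>lborel) \<partial>lborel)"
      by (simp add: J_i sum_negf)
    also have "(\<Sum>i\<in>Basis. \<integral>x. f x * (\<integral>y. K i y * ?D (x + y) i \<partial>lborel) \<partial>lborel) =
        (\<integral>x. f x * (\<Sum>i\<in>Basis. \<integral>y. K i y * ?D (x + y) i \<partial>lborel) \<partial>lborel)"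
      unfolding sum_distrib_left using i2 by (rule Bochner_Integration.integral_sum[symmetric])
    also have "\<dots> = (\<integral>x. n * (1 / t ^ DIM('a) * (f x * (\<integral>y. indicator (ball 0 t) y * \<phi> (x + y) \<partial>lborel)) - \<omega> * (\<phi> x * f x)) \<partial>lborel)"
      by (intro Bochner_Integration.integral_cong) (simp_all add: D_sum[OF refl] algebra_simps)
    also have "\<dots> = n * (1 / t ^ DIM('a) * (\<integral>x. \<phi> x * A x \<partial>lborel) - \<omega> * (\<integral>x. \<phi> x * f x \<partial>lborel))"
      using i3 i4 by (simp add: A_eq)
    \<comment> \<open>The minus sign of the integration by parts turns average minus value into
      value minus average.\<close>
    finally have J_eq: "(\<integral>x. \<phi> x * J x \<partial>lborel) = - (n * (1 / t ^ DIM('a) * (\<integral>x. \<phi> x * A x \<partial>lborel) - \<omega> * (\<integral>x. \<phi> x * f x \<partial>lborel)))" .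
    have "(\<integral>x. \<phi> x * ?N x \<partial>lborel) =
        (\<integral>x. \<phi> x * J x - (n * (\<omega> * (\<phi> x * f x) - 1 / t ^ DIM('a) * (\<phi> x * A x))) \<partial>lborel)"
      by (intro Bochner_Integration.integral_cong) (simp_all add: algebra_simps)
    also have "\<dots> = (\<integral>x. \<phi> x * J x \<partial>lborel) -
        n * (\<omega> * (\<integral>x. \<phi> x * f x \<partial>lborel) - 1 / t ^ DIM('a) * (\<integral>x. \<phi> x * A x \<partial>lborel))"
      using i4 i5 i6 by simp
    also have "\<dots> = 0"
      unfolding J_eq by (simp add: algebra_simps)
    finally show "(\<integral>x. \<phi> x * ?N x \<partial>lborel) = 0" .
  qed
  then show ?thesis
    by eventually_elim (simp add: J_def K_def A_def n_def \<omega>_def)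
qed

section \<open>All radii simultaneously\<close>

text \<open>A larger radius enlarges both the ball and the bracket, so one kernel dominates those of
  all smaller radii. The factor \<open>norm y\<close> neutralises the origin, where the convention 1
  / 0 = 0 makes the kernel negative.\<close>

lemma radial_kernel_mono:
  fixes y :: "'a::euclidean_space"
  assumes "0 < t" "t \<le> T"
  shows "\<bar>radial_kernel t y\<bar> * norm y \<le> radial_kernel T y * norm y"
proof (cases "y = 0 \<or> norm y \<ge> t")
  case True
  have "0 \<le> radial_kernel T y" if "y \<noteq> 0"
    using that by (auto simp: radial_kernel_def indicator_def frac_le power_mono)
  then have "0 \<le> radial_kernel T y * norm y"
    by (cases "y = 0") auto
  then show ?thesis
    using True by (auto simp: radial_kernel_eq_0)
next
  case False
  then have "0 < norm y" "norm y < t" by auto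
  then have "1 / t ^ DIM('a) \<le> 1 / norm y ^ DIM('a)"
    by (intro frac_le power_mono) auto
  moreover have "1 / T ^ DIM('a) \<le> 1 / t ^ DIM('a)"
    using assms by (intro frac_le power_mono) auto
  ultimately show ?thesis
    using False assms by (auto simp: radial_kernel_def intro!: mult_right_mono)
qed

text \<open>The balls are open, so an increasing sequence of radii makes the indicators converge at every
  point, the sphere included.\<close>

lemma indicator_ball_left_continuous:
  fixes q :: "nat \<Rightarrow> real" and y :: "'a::euclidean_space"
  assumes "q \<longlonglongrightarrow> t" "\<And>j. q j < t"
  shows "(\<lambda>j. indicator (ball 0 (q j)) y :: real) \<longlonglongrightarrow> indicator (ball 0 t) y"
proof (cases "norm y < t")
  case True
  then have "eventually (\<lambda>j. norm y < q j) sequentially"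
    using assms(1) by (rule order_tendstoD(1)[rotated])
  then show ?thesis
    using True by (intro tendsto_eventually) (auto elim: eventually_mono)
next
  case False
  then have "\<not> norm y < q j" for j
    using assms(2)[of j] by linarith
  then show ?thesis using False by simp
qed

lemma radial_kernel_left_continuous:
  fixes q :: "nat \<Rightarrow> real" and y :: "'a::euclidean_space"
  assumes "q \<longlonglongrightarrow> t" "\<And>j. q j < t" "t > 0"
  shows "(\<lambda>j. radial_kernel (q j) y) \<longlonglongrightarrow> radial_kernel t y"
  unfolding radial_kernel_def
  using assms(3) by (intro tendsto_intros indicator_ball_left_continuous assms(1,2)) auto

lemma rational_sequence_from_below:
  fixes t :: real
  assumes "t > 0"
  obtains q where "q \<longlonglongrightarrow> t" "\<And>j::nat. q j < t" "\<And>j. 0 < q j" "\<And>j. q j \<in> \<rat>"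
proof -
  have "\<exists>q\<in>\<rat>. max 0 (t - 1 / real (Suc j)) < q \<and> q < t" for j
    using assms by (intro Rats_dense_in_real) auto
  then obtain q where q: "\<And>j. q j \<in> \<rat>" "\<And>j. max 0 (t - 1 / real (Suc j)) < q j" "\<And>j. q j < t"
    by metis
  have "q \<longlonglongrightarrow> t"
  proof (rule tendsto_sandwich)
    show "(\<lambda>j. t - 1 / real (Suc j)) \<longlonglongrightarrow> t"
      using tendsto_diff[OF tendsto_const[of t] LIMSEQ_inverse_real_of_nat] by (simp add: inverse_eq_divide)
    show "(\<lambda>j. t) \<longlonglongrightarrow> t" by simp
    show "eventually (\<lambda>j. t - 1 / real (Suc j) \<le> q j) sequentially"
      using q(2) by (intro always_eventually allI) (meson less_imp_le max_less_iff_conj)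
    show "eventually (\<lambda>j. q j \<le> t) sequentially"
      using q(3) by (intro always_eventually allI less_imp_le)
  qed
  moreover have "0 < q j" for j
    using q(2)[of j] by simp
  ultimately show thesis
    using q(1,3) by (intro that[of q])
qed

text \<open>The limit along rational radii requires majorants that are integrable for the given x.
  The exceptional set therefore also contains, for each integer radius, the x at which the majorant
  of the kernel integral or that of the ball integral is not integrable. For given t, an integer
  radius not below t controls all smaller radii.\<close>

lemma AE_radial_representation:
  fixes f :: "'a::euclidean_space \<Rightarrow> real" and G :: "'a \<Rightarrow> 'a"
  assumes f: "ball_integrable f" and G: "\<And>i. i \<in> Basis \<Longrightarrow> ball_integrable (\<lambda>x. G x \<bullet> i)"
    and weak: "\<And>\<phi> i. test_function \<phi> \<Longrightarrow> i \<in> Basis \<Longrightarrow>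
      (\<integral>x. f x * frechet_derivative \<phi> (at x) i \<partial>lborel) = - (\<integral>x. (G x \<bullet> i) * \<phi> x \<partial>lborel)"
  shows "AE x in lborel. \<forall>t>0. integrable lborel (\<lambda>y. radial_kernel t y * (y \<bullet> G (x - y))) \<and>
    (\<integral>y. radial_kernel t y * (y \<bullet> G (x - y)) \<partial>lborel) =
    real DIM('a) * (measure lborel (ball (0::'a) 1) * f x - (\<integral>y. indicator (ball 0 t) y * f (x - y) \<partial>lborel) / t ^ DIM('a))"
proof -
  have Gm: "G \<in> borel_measurable borel"
    using G by (intro borel_measurable_euclidean_space[THEN iffD2]) (auto simp: ball_integrable_def)
  have fm: "f \<in> borel_measurable borel"
    using f by (simp add: ball_integrable_def)
  note [measurable] = Gm fm
  \<comment> \<open>The sum of absolute components in place of the Euclidean norm of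
    \<open>G\<close> keeps the majorant within reach of the scalar convolution lemmas. It dominates
    the inner product as well as each component product.\<close>
  let ?W = "\<lambda>m x y. (radial_kernel (real (Suc m)) y * norm y) * (\<Sum>i\<in>Basis. \<bar>G (x - y) \<bullet> i\<bar>)"
  have "AE x in lborel. integrable lborel (\<lambda>y. ?W m x y)" for m
    by (rule AE_integrable_convolution[OF integrable_radial_kernel_norm _
          ball_integrable_sum[OF ball_integrable_abs[OF G]], where T = "real (Suc m)"])
      (simp_all add: radial_kernel_eq_0 del: of_nat_Suc)
  then have W: "AE x in lborel. \<forall>m. integrable lborel (\<lambda>y. ?W m x y)"
    by (intro AE_all_countable[THEN iffD2] allI)
  have "AE x in lborel. integrable lborel (\<lambda>y. indicator (ball 0 (real (Suc m))) y * f (x - y))" for m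
    by (rule AE_integrable_convolution[OF integrable_indicator_ball _ f, where T = "real (Suc m)"]) simp
  then have V: "AE x in lborel. \<forall>m. integrable lborel (\<lambda>y. indicator (ball 0 (real (Suc m))) y * f (x - y))"
    by (intro AE_all_countable[THEN iffD2] allI)
  have "AE x in lborel. \<forall>q\<in>{q\<in>\<rat>. 0 < q}.
      (\<Sum>i\<in>Basis. convolution (\<lambda>y. radial_kernel q y * (y \<bullet> i)) (\<lambda>x. G x \<bullet> i) x) =
      real DIM('a) * (measure lborel (ball (0::'a) 1) * f x - convolution (indicator (ball 0 q)) f x / q ^ DIM('a))"
    by (intro AE_ball_countable[THEN iffD2] ballI AE_radial_convolution[OF f G weak])
      (auto intro: countable_subset[OF _ countable_rat])
  with W V show ?thesis
  proof eventually_elim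
    case (elim x)
    show ?case
    proof (intro allI impI)
      fix t :: real assume t: "t > 0"
      obtain m where m: "t \<le> real (Suc m)"
        using real_arch_simple[of t] by (metis le_SucI of_nat_le_iff order_trans order_refl)
      let ?I = "\<lambda>s y. radial_kernel s y * (y \<bullet> G (x - y))"
      have W: "integrable lborel (\<lambda>y. ?W m x y)"
        and V: "integrable lborel (\<lambda>y. indicator (ball 0 (real (Suc m))) y * f (x - y))"
        using elim(1,2) by auto
      have bound: "\<bar>radial_kernel s y\<bar> * (norm y * (\<Sum>i\<in>Basis. \<bar>G (x - y) \<bullet> i\<bar>)) \<le> ?W m x y"
        if "0 < s" "s \<le> t" for s y
        using mult_right_mono[OF radial_kernel_mono, of s "real (Suc m)" "\<Sum>i\<in>Basis. \<bar>G (x - y) \<bullet> i\<bar>" y] that m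
        by (simp add: mult.assoc sum_nonneg)
      have I_bound: "\<bar>?I s y\<bar> \<le> ?W m x y" if "0 < s" "s \<le> t" for s y
      proof -
        have "\<bar>y \<bullet> G (x - y)\<bar> \<le> norm y * (\<Sum>i\<in>Basis. \<bar>G (x - y) \<bullet> i\<bar>)"
          using Cauchy_Schwarz_ineq2[of y "G (x - y)"] mult_left_mono[OF norm_le_l1[of "G (x - y)"] norm_ge_zero[of y]]
          by linarith
        then have "\<bar>?I s y\<bar> \<le> \<bar>radial_kernel s y\<bar> * (norm y * (\<Sum>i\<in>Basis. \<bar>G (x - y) \<bullet> i\<bar>))"
          by (simp add: abs_mult mult_left_mono)
        with bound[OF that, of y] show ?thesis by linarith
      qed
      have I_int: "integrable lborel (?I s)" if "0 < s" "s \<le> t" for s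
        by (rule Bochner_Integration.integrable_bound[OF W])
          (use order_trans[OF I_bound[OF that] abs_ge_self] in \<open>auto intro!: AE_I2\<close>)
      \<comment> \<open>Integrability of the inner product does not give that of its summands, which
        is required to pull the basis sum out of the integral.\<close>
      have Ii_int: "integrable lborel (\<lambda>y. (radial_kernel s y * (y \<bullet> i)) * (G (x - y) \<bullet> i))"
        if "0 < s" "s \<le> t" "i \<in> Basis" for s i
      proof (rule Bochner_Integration.integrable_bound[OF W])
        show "AE y in lborel. norm ((radial_kernel s y * (y \<bullet> i)) * (G (x - y) \<bullet> i)) \<le> norm (?W m x y)"
        proof (intro AE_I2)
          fix y
          have "\<bar>G (x - y) \<bullet> i\<bar> \<le> (\<Sum>i\<in>Basis. \<bar>G (x - y) \<bullet> i\<bar>)"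
            using that(3) by (intro member_le_sum) auto
          then have "\<bar>y \<bullet> i\<bar> * \<bar>G (x - y) \<bullet> i\<bar> \<le> norm y * (\<Sum>i\<in>Basis. \<bar>G (x - y) \<bullet> i\<bar>)"
            using that(3) by (intro mult_mono Basis_le_norm) auto
          then have "\<bar>radial_kernel s y\<bar> * (\<bar>y \<bullet> i\<bar> * \<bar>G (x - y) \<bullet> i\<bar>) \<le> \<bar>radial_kernel s y\<bar> * (norm y * (\<Sum>i\<in>Basis. \<bar>G (x - y) \<bullet> i\<bar>))"
            by (intro mult_left_mono) auto
          with bound[OF that(1,2), of y]
          have "\<bar>(radial_kernel s y * (y \<bullet> i)) * (G (x - y) \<bullet> i)\<bar> \<le> ?W m x y"
            unfolding abs_mult mult.assoc by linarith
          from order_trans[OF this abs_ge_self]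
          show "norm ((radial_kernel s y * (y \<bullet> i)) * (G (x - y) \<bullet> i)) \<le> norm (?W m x y)"
            unfolding real_norm_def .
        qed
      qed measurable
      obtain q where q: "q \<longlonglongrightarrow> t" "\<And>j::nat. q j < t" "\<And>j. 0 < q j" "\<And>j. q j \<in> \<rat>"
        using rational_sequence_from_below[OF t] by metis
      let ?A = "\<lambda>s. \<integral>y. indicator (ball 0 s) y * f (x - y) \<partial>lborel"
      let ?R = "\<lambda>s. real DIM('a) * (measure lborel (ball (0::'a) 1) * f x - ?A s / s ^ DIM('a))"
      have eq: "(\<integral>y. ?I (q j) y \<partial>lborel) = ?R (q j)" for j
      proof -
        have "(\<integral>y. ?I (q j) y \<partial>lborel) =
            (\<integral>y. (\<Sum>i\<in>Basis. (radial_kernel (q j) y * (y \<bullet> i)) * (G (x - y) \<bullet> i)) \<partial>lborel)"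
          by (intro Bochner_Integration.integral_cong)
            (simp_all add: euclidean_inner[of _ "G _"] sum_distrib_left mult.assoc)
        also have "\<dots> = (\<Sum>i\<in>Basis. convolution (\<lambda>y. radial_kernel (q j) y * (y \<bullet> i)) (\<lambda>x. G x \<bullet> i) x)"
          unfolding convolution_def
          using Ii_int[OF q(3) less_imp_le[OF q(2)]] by (intro Bochner_Integration.integral_sum)
        also have "\<dots> = ?R (q j)"
          using elim(3) q(3,4) by (simp add: convolution_def)
        finally show ?thesis .
      qed
      have ball_m: "(\<lambda>y. indicator (ball 0 s) y * f (x - y)) \<in> borel_measurable borel" for s
        by (intro borel_measurable_times borel_measurable_indicator measurable_compose[OF _ fm]) auto
      have "(\<lambda>j. \<integral>y. ?I (q j) y \<partial>lborel) \<longlonglongrightarrow> (\<integral>y. ?I t y \<partial>lborel)"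
      proof (rule integral_dominated_convergence[where w = "\<lambda>y. ?W m x y"])
        show "AE y in lborel. (\<lambda>j. ?I (q j) y) \<longlonglongrightarrow> ?I t y"
          by (intro AE_I2 tendsto_mult_right radial_kernel_left_continuous q t)
        show "AE y in lborel. norm (?I (q j) y) \<le> ?W m x y" for j
          using I_bound[OF q(3) less_imp_le[OF q(2)]] by (intro AE_I2) (simp only: real_norm_def)
      qed (use W in measurable)
      moreover have "(\<lambda>j. ?A (q j)) \<longlonglongrightarrow> ?A t"
      proof (rule integral_dominated_convergence[where w = "\<lambda>y. \<bar>indicator (ball 0 (real (Suc m))) y * f (x - y)\<bar>"])
        show "AE y in lborel. (\<lambda>j. indicator (ball 0 (q j)) y * f (x - y)) \<longlonglongrightarrow> indicator (ball 0 t) y * f (x - y)"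
          by (intro AE_I2 tendsto_mult_right indicator_ball_left_continuous q)
        show "AE y in lborel. norm (indicator (ball 0 (q j)) y * f (x - y)) \<le> \<bar>indicator (ball 0 (real (Suc m))) y * f (x - y)\<bar>" for j
          using q(2)[of j] m by (intro AE_I2) (auto simp: indicator_def)
      qed (use V ball_m in auto)
      then have "(\<lambda>j. ?R (q j)) \<longlonglongrightarrow> ?R t"
        using q(1) t by (intro tendsto_intros) auto
      ultimately have "(\<integral>y. ?I t y \<partial>lborel) = ?R t"
        unfolding eq by (rule LIMSEQ_unique)
      then show "integrable lborel (?I t) \<and> (\<integral>y. ?I t y \<partial>lborel) = ?R t"
        using I_int[OF t] by simp
    qed
  qed
qed

section \<open>Passage between Lebesgue measurable functions and Borel representatives\<close>

lemma lebesgue_AE_eq_borel: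
  fixes F g :: "'a::euclidean_space \<Rightarrow> real"
  assumes g[measurable]: "g \<in> borel_measurable borel" and "AE x in lborel. F x = g x"
  shows "integrable lebesgue F \<longleftrightarrow> integrable lborel g"
    and "(\<integral>x. F x \<partial>lebesgue) = (\<integral>x. g x \<partial>lborel)"
proof -
  have ae: "AE x in lebesgue. F x = g x"
    using assms(2) by (rule AE_completion)
  have gm: "g \<in> borel_measurable lebesgue"
    by (intro measurable_completion) simp
  \<comment> \<open>Completeness of \<open>lebesgue\<close> makes \<open>F\<close> measurable, being
    almost everywhere equal to a Borel function.\<close>
  have Fm: "F \<in> borel_measurable lebesgue"
    by (rule borel_measurable_AE[OF gm]) (use ae in auto)
  have "integrable lebesgue F \<longleftrightarrow> integrable lebesgue g"
    by (rule integrable_cong_AE[OF Fm gm ae])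
  then show "integrable lebesgue F \<longleftrightarrow> integrable lborel g"
    by (simp add: integrable_completion)
  have "(\<integral>x. F x \<partial>lebesgue) = (\<integral>x. g x \<partial>lebesgue)"
    by (rule integral_cong_AE[OF Fm gm ae])
  then show "(\<integral>x. F x \<partial>lebesgue) = (\<integral>x. g x \<partial>lborel)"
    by (simp add: integral_completion)
qed

lemma locally_integrable_borel_representative:
  fixes f :: "'a::euclidean_space \<Rightarrow> real"
  assumes "locally_integrable f"
  obtains g where "ball_integrable g" "AE x in lborel. f x = g x"
proof -
  have int: "integrable lebesgue (\<lambda>x. indicator (cball 0 R) x * f x)" for R
    using assms by (auto simp: locally_integrable_def set_integrable_def)
  \<comment> \<open>Local integrability gives measurability of truncations to balls only; at each
    point these are eventually equal to \<open>f\<close>.\<close>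
  have "f \<in> borel_measurable lebesgue"
  proof (rule borel_measurable_LIMSEQ_real)
    show "(\<lambda>x. indicator (cball 0 (real m)) x * f x) \<in> borel_measurable lebesgue" for m
      using int by (rule borel_measurable_integrable)
    fix x :: 'a
    obtain m where "norm x \<le> real m"
      using real_arch_simple by blast
    then have "eventually (\<lambda>m. norm x \<le> real m) sequentially"
      by (auto simp: eventually_sequentially intro!: exI[of _ m])
    then have "eventually (\<lambda>m. indicator (cball 0 (real m)) x * f x = f x) sequentially"
      by eventually_elim simp
    then show "(\<lambda>m. indicator (cball 0 (real m)) x * f x) \<longlonglongrightarrow> f x"
      by (rule tendsto_eventually)
  qed
  then obtain g where g: "g \<in> borel_measurable lborel" "AE x in lborel. f x = g x"
    using completion_ex_borel_measurable_real by blast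
  have "integrable lborel (\<lambda>x. indicator (cball 0 R) x * g x)" for R
  proof (subst lebesgue_AE_eq_borel(1)[symmetric])
    show "AE x in lborel. indicator (cball 0 R) x * f x = indicator (cball 0 R) x * g x"
      using g(2) by eventually_elim simp
    have "g \<in> borel_measurable borel" using g(1) by simp
    then show "(\<lambda>x. indicator (cball 0 R) x * g x) \<in> borel_measurable borel"
      by (intro borel_measurable_times borel_measurable_indicator) auto
  qed (rule int)
  then show thesis
    using g by (intro that[of g]) (auto simp: ball_integrable_def)
qed

section \<open>Scaling of the kernel and the final assembly\<close>

lemma esqrt_mult: "c \<ge> 0 \<Longrightarrow> c \<noteq> 0 \<Longrightarrow> esqrt (ennreal (c\<^sup>2) * a) = ennreal c * esqrt a"
  by (cases a) (auto simp: esqrt_def ennreal_mult_top top_unique real_sqrt_mult simp flip: ennreal_mult)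

text \<open>Both terms of \<open>psi (y /\<^sub>R t) /\<^sub>R t ^ DIM('a)\<close> carry exactly one
  factor 1/t besides the kernel. Squared, it changes the weight dt / t into dt / t^3.\<close>

lemma psi_scaled_inner:
  fixes y v :: "'a::euclidean_space"
  assumes "t > 0"
  shows "psi_scaled t y \<bullet> v =
    1 / (real DIM('a) * unit_ball_vol (real DIM('a)) * t) * (radial_kernel t y * (y \<bullet> v))"
proof (cases "norm y < t \<and> y \<noteq> 0")
  case True
  moreover have "unit_ball_vol (real DIM('a)) \<noteq> 0"
    using unit_ball_vol_pos[of "real DIM('a)"] by linarith
  ultimately show ?thesis
    using assms
    by (simp add: psi_scaled_def psi_def radial_kernel_def inner_diff_left power_mult_distrib power_divide field_simps)
next
  case False
  then consider "y = 0" | "norm y \<ge> t" by force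
  then show ?thesis
    by cases (use assms in \<open>simp_all add: psi_scaled_def psi_def radial_kernel_eq_0 field_simps\<close>)
qed

text \<open>On the sphere \<open>norm y = t\<close> the difference on the left is 0, so the closed
  ball agrees with the open one of \<open>radial_kernel\<close> at every point and not just almost
  everywhere.\<close>

lemma cball_kernel_inner:
  fixes y v :: "'a::euclidean_space"
  shows "indicator (cball 0 t) y *\<^sub>R ((y /\<^sub>R norm y ^ DIM('a) - y /\<^sub>R t ^ DIM('a)) \<bullet> v) =
    radial_kernel t y * (y \<bullet> v)"
  by (cases "norm y = t")
    (auto simp: radial_kernel_def indicator_def inner_diff_left field_simps)

text \<open>The integrability clauses give the integrals their meaning, because a Bochner integral
  that does not exist is 0 by convention. \<open>Df\<close> is an arbitrary representative of the
  weak gradient, and the null set does not depend on t.\<close>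

theorem lemma1p7:
  fixes f :: "'a::euclidean_space \<Rightarrow> real" and Df :: "'a \<Rightarrow> 'a"
  assumes "f \<in> W11_loc" and "weak_gradient f Df"
  shows "AE x in lebesgue.
    (\<forall>t>0. integrable lebesgue (\<lambda>y. psi_scaled t y \<bullet> Df (x - y)) \<and>
       set_integrable lebesgue (cball 0 t)
         (\<lambda>y. (y /\<^sub>R norm y ^ DIM('a) - y /\<^sub>R t ^ DIM('a)) \<bullet> Df (x - y))) \<and>
    square_function f x =
      esqrt (\<integral>\<^sup>+t\<in>{0<..}. ennreal (\<bar>convolution_inner (psi_scaled t) Df x\<bar>\<^sup>2 / t) \<partial>lborel) \<and>
    esqrt (\<integral>\<^sup>+t\<in>{0<..}. ennreal (\<bar>convolution_inner (psi_scaled t) Df x\<bar>\<^sup>2 / t) \<partial>lborel) =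
      ennreal (1 / (real DIM('a) * unit_ball_vol (real DIM('a)))) *
      esqrt (\<integral>\<^sup>+t\<in>{0<..}. ennreal
        (\<bar>\<integral>y\<in>cball 0 t. (y /\<^sub>R norm y ^ DIM('a) - y /\<^sub>R t ^ DIM('a)) \<bullet> Df (x - y) \<partial>lebesgue\<bar>\<^sup>2
          / t ^ 3) \<partial>lborel)"
proof -
  define c where "c = real DIM('a) * unit_ball_vol (real DIM('a))"
  have c: "c > 0"
    by (simp add: c_def)
  have weak: "weak_derivative i f (\<lambda>x. Df x \<bullet> i)" if "i \<in> Basis" for i
    using assms(2) that by (simp add: weak_gradient_def)
  have "locally_integrable f"
    using assms(1) by (simp add: W11_loc_def)
  then obtain g where g: "ball_integrable g" "AE x in lborel. f x = g x"
    using locally_integrable_borel_representative by blast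
  \<comment> \<open>Borel representatives are chosen for the scalar components and assembled into
    the vector field \<open>G\<close> afterwards.\<close>
  have "\<exists>h. ball_integrable h \<and> (AE x in lborel. Df x \<bullet> i = h x)" if "i \<in> Basis" for i
    using weak[OF that] locally_integrable_borel_representative[of "\<lambda>x. Df x \<bullet> i"]
    unfolding weak_derivative_def by metis
  then obtain h where h: "\<And>i. i \<in> Basis \<Longrightarrow> ball_integrable (h i)"
      "\<And>i. i \<in> Basis \<Longrightarrow> AE x in lborel. Df x \<bullet> i = h i x"
    by metis
  define G where "G = (\<lambda>x. \<Sum>i\<in>Basis. h i x *\<^sub>R i)"
  have G_inner: "G x \<bullet> i = h i x" if "i \<in> Basis" for x i
    using that by (simp add: G_def)
  have G: "ball_integrable (\<lambda>x. G x \<bullet> i)" if "i \<in> Basis" for i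
    using h(1)[OF that] by (simp add: G_inner[OF that])
  have "AE x in lborel. \<forall>i\<in>Basis. Df x \<bullet> i = h i x"
    using h(2) by (simp add: AE_ball_countable countable_finite)
  then have Df_G: "AE x in lborel. Df x = G x"
    by eventually_elim (simp add: euclidean_eq_iff[where 'a = 'a] G_inner)
  have gm[measurable]: "g \<in> borel_measurable borel"
    using g by (simp add: ball_integrable_def)
  have Gm[measurable]: "G \<in> borel_measurable borel"
    using G by (intro borel_measurable_euclidean_space[THEN iffD2]) (auto simp: ball_integrable_def)
  have weak_borel: "(\<integral>x. g x * frechet_derivative \<phi> (at x) i \<partial>lborel) = - (\<integral>x. (G x \<bullet> i) * \<phi> x \<partial>lborel)"
    if \<phi>: "test_function \<phi>" and i: "i \<in> Basis" for \<phi> i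
  proof -
    have [measurable]: "\<phi> \<in> borel_measurable borel" "(\<lambda>x. frechet_derivative \<phi> (at x) i) \<in> borel_measurable borel"
      using test_function_continuous[OF \<phi>] test_function_continuous_derivative[OF \<phi> i]
      by (auto intro: borel_measurable_continuous_onI)
    have "(\<integral>x. f x * frechet_derivative \<phi> (at x) i \<partial>lebesgue) = (\<integral>x. g x * frechet_derivative \<phi> (at x) i \<partial>lborel)"
      by (rule lebesgue_AE_eq_borel(2)) (use g(2) in auto)
    moreover have "(\<integral>x. (Df x \<bullet> i) * \<phi> x \<partial>lebesgue) = (\<integral>x. (G x \<bullet> i) * \<phi> x \<partial>lborel)"
      by (rule lebesgue_AE_eq_borel(2)) (use Df_G in auto)
    ultimately show ?thesis
      using weak[OF i] \<phi> by (simp add: weak_derivative_def)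
  qed
  have representation: "AE x in lborel. \<forall>t>0. integrable lborel (\<lambda>y. radial_kernel t y * (y \<bullet> G (x - y))) \<and>
    (\<integral>y. radial_kernel t y * (y \<bullet> G (x - y)) \<partial>lborel) =
    real DIM('a) * (measure lborel (ball (0::'a) 1) * g x - (\<integral>y. indicator (ball 0 t) y * g (x - y) \<partial>lborel) / t ^ DIM('a))"
    by (rule AE_radial_representation[OF g(1) G weak_borel])
  show ?thesis
  proof (rule AE_completion, use g(2) representation in eventually_elim)
    case (elim x)
    define J where "J = (\<lambda>t. \<integral>y. radial_kernel t y * (y \<bullet> G (x - y)) \<partial>lborel)"
    \<comment> \<open>Reflection y \<mapsto> x - y preserves null sets, so \<open>Df\<close> may be
      replaced by \<open>G\<close> inside the integrals for every x, without enlarging the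
      exceptional set.\<close>
    have ae: "AE y in lborel. Df (x - y) = G (x - y)"
      using AE_lborel_affine[of "-1" "\<lambda>x. Df x = G x" x] Df_G by simp
    have Gx[measurable]: "(\<lambda>y. G (x - y)) \<in> borel_measurable borel"
      by measurable
    have km: "(\<lambda>y. radial_kernel t y * (y \<bullet> G (x - y))) \<in> borel_measurable borel" for t
      by measurable
    have psi: "integrable lebesgue (\<lambda>y. psi_scaled t y \<bullet> Df (x - y))"
        "convolution_inner (psi_scaled t) Df x = J t / (c * t)" if t: "t > 0" for t
    proof -
      have e: "AE y in lborel. psi_scaled t y \<bullet> Df (x - y) = 1 / (c * t) * (radial_kernel t y * (y \<bullet> G (x - y)))"
        using ae by eventually_elim (simp add: psi_scaled_inner[OF t] c_def)
      have "integrable lborel (\<lambda>y. 1 / (c * t) * (radial_kernel t y * (y \<bullet> G (x - y))))"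
        using elim(2) t by (intro integrable_mult_right) auto
      then show "integrable lebesgue (\<lambda>y. psi_scaled t y \<bullet> Df (x - y))"
        using lebesgue_AE_eq_borel(1)[OF _ e] km by simp
      show "convolution_inner (psi_scaled t) Df x = J t / (c * t)"
        unfolding convolution_inner_def using lebesgue_AE_eq_borel(2)[OF _ e] km by (simp add: J_def)
    qed
    have set_int: "set_integrable lebesgue (cball 0 t) (\<lambda>y. (y /\<^sub>R norm y ^ DIM('a) - y /\<^sub>R t ^ DIM('a)) \<bullet> Df (x - y))"
        "(\<integral>y\<in>cball 0 t. (y /\<^sub>R norm y ^ DIM('a) - y /\<^sub>R t ^ DIM('a)) \<bullet> Df (x - y) \<partial>lebesgue) = J t" if t: "t > 0" for t
    proof -
      have e: "AE y in lborel. indicator (cball 0 t) y *\<^sub>R ((y /\<^sub>R norm y ^ DIM('a) - y /\<^sub>R t ^ DIM('a)) \<bullet> Df (x - y)) =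
          radial_kernel t y * (y \<bullet> G (x - y))"
        using ae by eventually_elim (simp only: cball_kernel_inner)
      show "set_integrable lebesgue (cball 0 t) (\<lambda>y. (y /\<^sub>R norm y ^ DIM('a) - y /\<^sub>R t ^ DIM('a)) \<bullet> Df (x - y))"
        unfolding set_integrable_def using lebesgue_AE_eq_borel(1)[OF km e] elim(2) t by blast
      show "(\<integral>y\<in>cball 0 t. (y /\<^sub>R norm y ^ DIM('a) - y /\<^sub>R t ^ DIM('a)) \<bullet> Df (x - y) \<partial>lebesgue) = J t"
        unfolding set_lebesgue_integral_def J_def by (rule lebesgue_AE_eq_borel(2)[OF km e])
    qed
    have ball_m: "(\<lambda>y. indicator (ball x t) y * g y) \<in> borel_measurable borel" for t
      by (intro borel_measurable_times borel_measurable_indicator gm) auto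
    have average: "f x - ball_average f x t = J t / c" if t: "t > 0" for t
    proof -
      have "(\<integral>y\<in>ball x t. f y \<partial>lebesgue) = (\<integral>y. indicator (ball x t) y * g y \<partial>lborel)"
        unfolding set_lebesgue_integral_def by (rule lebesgue_AE_eq_borel(2)[OF ball_m]) (use g(2) in auto)
      also have "\<dots> = (\<integral>y. indicator (ball x t) (x - y) * g (x - y) \<partial>lborel)"
        using lborel_integral_affine[OF _ ball_m, of "-1" t x] by simp
      also have "\<dots> = (\<integral>y. indicator (ball 0 t) y * g (x - y) \<partial>lborel)"
        by (intro Bochner_Integration.integral_cong) (auto simp: indicator_def dist_norm)
      finally have average_eq: "ball_average f x t =
          (\<integral>y. indicator (ball 0 t) y * g (x - y) \<partial>lborel) / (unit_ball_vol (real DIM('a)) * t ^ DIM('a))"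
        using t by (simp add: ball_average_def content_ball)
      have J_eq: "J t = real DIM('a) * (unit_ball_vol (real DIM('a)) * g x - (\<integral>y. indicator (ball 0 t) y * g (x - y) \<partial>lborel) / t ^ DIM('a))"
        using elim(2) t by (simp add: J_def content_ball)
      have "unit_ball_vol (real DIM('a)) \<noteq> 0"
        using unit_ball_vol_pos[of "real DIM('a)"] by linarith
      then show ?thesis
        unfolding average_eq J_eq c_def using elim(1) t by (simp add: field_simps)
    qed
    \<comment> \<open>The indicator of a ball that depends on t is rewritten as a condition jointly
      measurable in t and y, from which measurability of the parametrised integral follows.\<close>
    have "J = (\<lambda>t. \<integral>y. (if norm y < t then (1 / norm y ^ DIM('a) - 1 / t ^ DIM('a)) * (y \<bullet> G (x - y)) else 0) \<partial>lborel)"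
      unfolding J_def radial_kernel_def
      by (intro ext Bochner_Integration.integral_cong) (auto simp: indicator_def)
    then have Jm: "J \<in> borel_measurable borel"
      by simp
    \<comment> \<open>The integrands already agree for each t > 0: the difference is
      \<open>J t / c\<close>, the convolution is \<open>J t / (c * t)\<close>, and the extra
      t\<dots> in the denominator, squared, accounts for t^3 against t.\<close>
    have S: "(\<integral>\<^sup>+t\<in>{0<..}. ennreal (\<bar>f x - ball_average f x t\<bar>\<^sup>2 / t ^ 3) \<partial>lborel) =
        (\<integral>\<^sup>+t\<in>{0<..}. ennreal (\<bar>convolution_inner (psi_scaled t) Df x\<bar>\<^sup>2 / t) \<partial>lborel)"
      by (intro nn_integral_cong)
        (auto simp: indicator_def average psi power2_eq_square power3_eq_cube)
    have P: "(\<integral>\<^sup>+t\<in>{0<..}. ennreal (\<bar>convolution_inner (psi_scaled t) Df x\<bar>\<^sup>2 / t) \<partial>lborel) =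
        ennreal ((1 / c)\<^sup>2) * (\<integral>\<^sup>+t\<in>{0<..}. ennreal (\<bar>J t\<bar>\<^sup>2 / t ^ 3) \<partial>lborel)"
      using Jm c
      by (subst nn_integral_cmult[symmetric])
        (auto intro!: nn_integral_cong simp: indicator_def psi power2_eq_square power3_eq_cube field_simps simp flip: ennreal_mult)
    have Q: "(\<integral>\<^sup>+t\<in>{0<..}. ennreal (\<bar>\<integral>y\<in>cball 0 t. (y /\<^sub>R norm y ^ DIM('a) - y /\<^sub>R t ^ DIM('a)) \<bullet> Df (x - y) \<partial>lebesgue\<bar>\<^sup>2 / t ^ 3) \<partial>lborel) =
        (\<integral>\<^sup>+t\<in>{0<..}. ennreal (\<bar>J t\<bar>\<^sup>2 / t ^ 3) \<partial>lborel)"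
      by (intro nn_integral_cong) (auto simp: indicator_def set_int)
    show ?case
      unfolding square_function_def S Q P c_def[symmetric]
      using psi(1) set_int(1) c by (auto simp: esqrt_mult)
  qed
qed

end
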